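(* For any clan $\mathcal{T}$, the 0-extensions in $\mathcal{T}\text{-}\mathsf{Mod}$ are flat.
   Context: A clan is a small category $\mathcal{T}$ with a distinguished class of arrows called display maps such that: (i) pullbacks of display maps along arbitrary maps exist and are display maps; (ii) isomorphisms and composites of display maps are display maps; (iii) $\mathcal{T}$ has a terminal object and all maps to it are display maps. A model of $\mathcal{T}$ is a functor $A:\mathcal{T}\to\mathsf{Set}$ preserving the terminal object and pullbacks of display maps; $\mathcal{T}\text{-}\mathsf{Mod}\subseteq[\mathcal{T},\mathsf{Set}]$ is the full subcategory on models. Representables $H(\Gamma)=\mathcal{T}(\Gamma,-)$ are models. A map in $\mathcal{T}\text{-}\mathsf{Mod}$ is full if it has the right lifting property w.r.t. all $H(p)$, $p$ a display map; it is an extension if it has the left lifting property w.r.t. all full maps. A 0-extension is an object $A$ such that the map from the initial model $0\to A$ is an extension. A model $A$ is flat if the category $\mathsf{El}(A)$ is filtered, where $\mathsf{El}(A)$ has objects pairs $(\Gamma,x)$ with $x\in A(\Gamma)$ and arrows $(\Gamma,x)\to(\Delta,y)$ the arrows $s:\Delta\to\Gamma$ in $\mathcal{T}$ with $A(s)(y)=x$ (so that $\mathsf{El}(A)$ projects to $\mathcal{T}^{\mathsf{op}}$). *)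

theory Defs
  imports Main "HOL-Library.FuncSet"
begin

section \<open>Categories\<close>

record ('o, 'a) cat =
  Ob :: "'o set"
  Ar :: "'a set"
  src :: "'a \<Rightarrow> 'o"
  trg :: "'a \<Rightarrow> 'o"
  idn :: "'o \<Rightarrow> 'a"
  cmp :: "'a \<Rightarrow> 'a \<Rightarrow> 'a"  (infixr "\<cdot>\<index>" 70)

definition hom :: "('o, 'a, 'm) cat_scheme \<Rightarrow> 'o \<Rightarrow> 'o \<Rightarrow> 'a set" where
  "hom C x y = {f \<in> Ar C. src C f = x \<and> trg C f = y}"

locale category =
  fixes C :: "('o, 'a, 'm) cat_scheme" (structure)
  assumes src_Ob: "f \<in> Ar C \<Longrightarrow> src C f \<in> Ob C"
    and trg_Ob: "f \<in> Ar C \<Longrightarrow> trg C f \<in> Ob C"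
    and idn_hom: "x \<in> Ob C \<Longrightarrow> idn C x \<in> hom C x x"
    and cmp_hom: "\<lbrakk>g \<in> hom C y z; f \<in> hom C x y\<rbrakk> \<Longrightarrow> g \<cdot> f \<in> hom C x z"
    and idn_right: "f \<in> hom C x y \<Longrightarrow> f \<cdot> idn C x = f"
    and idn_left: "f \<in> hom C x y \<Longrightarrow> idn C y \<cdot> f = f"
    and cmp_assoc: "\<lbrakk>h \<in> hom C z w; g \<in> hom C y z; f \<in> hom C x y\<rbrakk>
      \<Longrightarrow> (h \<cdot> g) \<cdot> f = h \<cdot> (g \<cdot> f)"

definition iso :: "('o, 'a, 'm) cat_scheme \<Rightarrow> 'a \<Rightarrow> bool" where
  "iso C f \<longleftrightarrow> f \<in> Ar C \<and>
     (\<exists>g \<in> hom C (trg C f) (src C f).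
        g \<cdot>\<^bsub>C\<^esub> f = idn C (src C f) \<and> f \<cdot>\<^bsub>C\<^esub> g = idn C (trg C f))"

definition terminal :: "('o, 'a, 'm) cat_scheme \<Rightarrow> 'o \<Rightarrow> bool" where
  "terminal C t \<longleftrightarrow> t \<in> Ob C \<and> (\<forall>x \<in> Ob C. \<exists>!f. f \<in> hom C x t)"

(*
  is_pullback C f p p' q: the following square commutes and is a pullback;
  p' is the pullback of p along f.

          q
       P ---> E
   p'  |      |  p
       v      v
       D ---> G
          f
*)
definition is_pullback ::
    "('o, 'a, 'm) cat_scheme \<Rightarrow> 'a \<Rightarrow> 'a \<Rightarrow> 'a \<Rightarrow> 'a \<Rightarrow> bool" where
  "is_pullback C f p p' q \<longleftrightarrow>
     f \<in> Ar C \<and> p \<in> Ar C \<and> trg C f = trg C p \<and>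
     p' \<in> Ar C \<and> q \<in> Ar C \<and> src C p' = src C q \<and>
     trg C p' = src C f \<and> trg C q = src C p \<and>
     f \<cdot>\<^bsub>C\<^esub> p' = p \<cdot>\<^bsub>C\<^esub> q \<and>
     (\<forall>X \<in> Ob C. \<forall>u \<in> hom C X (src C f). \<forall>v \<in> hom C X (src C p).
        f \<cdot>\<^bsub>C\<^esub> u = p \<cdot>\<^bsub>C\<^esub> v \<longrightarrow>
        (\<exists>!w. w \<in> hom C X (src C p') \<and> p' \<cdot>\<^bsub>C\<^esub> w = u \<and> q \<cdot>\<^bsub>C\<^esub> w = v))"

definition filtered :: "('o, 'a, 'm) cat_scheme \<Rightarrow> bool" where
  "filtered C \<longleftrightarrow>
     Ob C \<noteq> {} \<and>
     (\<forall>x \<in> Ob C. \<forall>y \<in> Ob C. \<exists>z \<in> Ob C. hom C x z \<noteq> {} \<and> hom C y z \<noteq> {}) \<and>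
     (\<forall>x \<in> Ob C. \<forall>y \<in> Ob C. \<forall>f \<in> hom C x y. \<forall>g \<in> hom C x y.
        \<exists>z \<in> Ob C. \<exists>h \<in> hom C y z. h \<cdot>\<^bsub>C\<^esub> f = h \<cdot>\<^bsub>C\<^esub> g)"

section \<open>Clans\<close>

record ('o, 'a) clan_data = "('o, 'a) cat" +
  Disp :: "'a set"

locale clan = category T for T :: "('o, 'a, 'm) clan_data_scheme" (structure) +
  assumes Disp_Ar: "Disp T \<subseteq> Ar T"
    and pullback_exists: "\<lbrakk>p \<in> Disp T; f \<in> Ar T; trg T f = trg T p\<rbrakk>
      \<Longrightarrow> \<exists>p' q. is_pullback T f p p' q"
    and pullback_Disp: "\<lbrakk>p \<in> Disp T; is_pullback T f p p' q\<rbrakk> \<Longrightarrow> p' \<in> Disp T"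
    and iso_Disp: "iso T f \<Longrightarrow> f \<in> Disp T"
    and cmp_Disp: "\<lbrakk>p \<in> Disp T; q \<in> Disp T; src T q = trg T p\<rbrakk> \<Longrightarrow> q \<cdot> p \<in> Disp T"
    and terminal_exists: "\<exists>t. terminal T t"
    and to_terminal_Disp: "\<lbrakk>terminal T t; f \<in> Ar T; trg T f = t\<rbrakk> \<Longrightarrow> f \<in> Disp T"

section \<open>Set-valued functors and natural transformations\<close>

text \<open>
  A type \<open>'u\<close> plays the role of the universe: the objects of the category of sets are the sets of
  type \<open>'u set\<close>.  All data are total functions in HOL; their values outside the relevant carriers
  are irrelevant, so natural transformations are compared only on the carriers (\<open>nt_eq\<close>).
  That a category \<open>C\<close> is small for this universe means that \<open>Ar C\<close> (and hence \<open>Ob C\<close>, through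
  identities) injects into \<open>'u\<close>; results about models moreover need \<open>'u\<close> to be infinite, i.e. the
  universe to contain the natural numbers.  As \<open>'u\<close> is an arbitrary type subject to these conditions,
  nothing is lost: every set-sized family of sets lives in some such type.
\<close>

record ('o, 'a, 'u) set_functor =
  onOb :: "'o \<Rightarrow> 'u set"
  onAr :: "'a \<Rightarrow> 'u \<Rightarrow> 'u"

definition is_functor ::
    "('o, 'a, 'm) cat_scheme \<Rightarrow> ('o, 'a, 'u) set_functor \<Rightarrow> bool" where
  "is_functor C A \<longleftrightarrow>
     (\<forall>f \<in> Ar C. onAr A f \<in> onOb A (src C f) \<rightarrow> onOb A (trg C f)) \<and>
     (\<forall>x \<in> Ob C. \<forall>a \<in> onOb A x. onAr A (idn C x) a = a) \<and>
     (\<forall>f \<in> Ar C. \<forall>g \<in> Ar C. src C g = trg C f \<longrightarrow>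
        (\<forall>a \<in> onOb A (src C f). onAr A (g \<cdot>\<^bsub>C\<^esub> f) a = onAr A g (onAr A f a)))"

definition is_nt ::
    "('o, 'a, 'm) cat_scheme \<Rightarrow> ('o, 'a, 'u) set_functor \<Rightarrow> ('o, 'a, 'v) set_functor
      \<Rightarrow> ('o \<Rightarrow> 'u \<Rightarrow> 'v) \<Rightarrow> bool" where
  "is_nt C A B t \<longleftrightarrow>
     (\<forall>x \<in> Ob C. t x \<in> onOb A x \<rightarrow> onOb B x) \<and>
     (\<forall>f \<in> Ar C. \<forall>a \<in> onOb A (src C f).
        t (trg C f) (onAr A f a) = onAr B f (t (src C f) a))"

definition nt_eq ::
    "('o, 'a, 'm) cat_scheme \<Rightarrow> ('o, 'a, 'u) set_functor
      \<Rightarrow> ('o \<Rightarrow> 'u \<Rightarrow> 'v) \<Rightarrow> ('o \<Rightarrow> 'u \<Rightarrow> 'v) \<Rightarrow> bool" where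
  "nt_eq C A s t \<longleftrightarrow> (\<forall>x \<in> Ob C. \<forall>a \<in> onOb A x. s x a = t x a)"

definition nt_cmp :: "('o \<Rightarrow> 'v \<Rightarrow> 'w) \<Rightarrow> ('o \<Rightarrow> 'u \<Rightarrow> 'v) \<Rightarrow> 'o \<Rightarrow> 'u \<Rightarrow> 'w" where
  "nt_cmp t s = (\<lambda>x a. t x (s x a))"

section \<open>Models\<close>

text \<open>
  Preservation of a pullback square is expressed by the comparison map into the canonical fibre
  product of sets being a bijection.
\<close>

definition model ::
    "('o, 'a, 'm) clan_data_scheme \<Rightarrow> ('o, 'a, 'u) set_functor \<Rightarrow> bool" where
  "model T A \<longleftrightarrow>
     is_functor T A \<and>
     (\<forall>t. terminal T t \<longrightarrow> (\<exists>!a. a \<in> onOb A t)) \<and>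
     (\<forall>f p p' q. p \<in> Disp T \<longrightarrow> is_pullback T f p p' q \<longrightarrow>
        bij_betw (\<lambda>w. (onAr A p' w, onAr A q w))
          (onOb A (src T p'))
          {(y, z). y \<in> onOb A (src T f) \<and> z \<in> onOb A (src T p) \<and> onAr A f y = onAr A p z})"

definition repr :: "('o, 'a, 'm) cat_scheme \<Rightarrow> 'o \<Rightarrow> ('o, 'a, 'a) set_functor" where
  "repr C x = \<lparr>onOb = hom C x, onAr = (\<lambda>g f. g \<cdot>\<^bsub>C\<^esub> f)\<rparr>"

text \<open>For \<open>p : x \<rightarrow> y\<close>, this is the transformation \<open>repr C y \<rightarrow> repr C x\<close> of precomposition.\<close>

definition repr_map :: "('o, 'a, 'm) cat_scheme \<Rightarrow> 'a \<Rightarrow> 'o \<Rightarrow> 'a \<Rightarrow> 'a" where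
  "repr_map C p = (\<lambda>_ g. g \<cdot>\<^bsub>C\<^esub> p)"

definition initial_model ::
    "('o, 'a, 'm) clan_data_scheme \<Rightarrow> ('o, 'a, 'u) set_functor \<Rightarrow> bool" where
  "initial_model T Z \<longleftrightarrow> model T Z \<and>
     (\<forall>B :: ('o, 'a, 'u) set_functor. model T B \<longrightarrow>
        (\<exists>t. is_nt T Z B t \<and> (\<forall>t'. is_nt T Z B t' \<longrightarrow> nt_eq T Z t' t)))"

section \<open>Full maps and extensions\<close>

text \<open>
  \<open>lifts T A B i X Y f\<close>: the map \<open>i : A \<rightarrow> B\<close> has the left lifting property with respect to
  \<open>f : X \<rightarrow> Y\<close>.  The two maps may take values in different types, so that representables,
  whose elements are arrows of \<open>T\<close>, need not be copied into the universe \<open>'u\<close>.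
\<close>

definition lifts ::
    "('o, 'a, 'm) cat_scheme
      \<Rightarrow> ('o, 'a, 'u) set_functor \<Rightarrow> ('o, 'a, 'u) set_functor \<Rightarrow> ('o \<Rightarrow> 'u \<Rightarrow> 'u)
      \<Rightarrow> ('o, 'a, 'v) set_functor \<Rightarrow> ('o, 'a, 'v) set_functor \<Rightarrow> ('o \<Rightarrow> 'v \<Rightarrow> 'v) \<Rightarrow> bool" where
  "lifts T A B i X Y f \<longleftrightarrow>
     (\<forall>u v. is_nt T A X u \<longrightarrow> is_nt T B Y v \<longrightarrow> nt_eq T A (nt_cmp f u) (nt_cmp v i) \<longrightarrow>
        (\<exists>h. is_nt T B X h \<and> nt_eq T A (nt_cmp h i) u \<and> nt_eq T B (nt_cmp f h) v))"

definition full_map ::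
    "('o, 'a, 'm) clan_data_scheme
      \<Rightarrow> ('o, 'a, 'u) set_functor \<Rightarrow> ('o, 'a, 'u) set_functor \<Rightarrow> ('o \<Rightarrow> 'u \<Rightarrow> 'u) \<Rightarrow> bool" where
  "full_map T X Y f \<longleftrightarrow>
     model T X \<and> model T Y \<and> is_nt T X Y f \<and>
     (\<forall>p \<in> Disp T. lifts T (repr T (trg T p)) (repr T (src T p)) (repr_map T p) X Y f)"

definition extension ::
    "('o, 'a, 'm) clan_data_scheme
      \<Rightarrow> ('o, 'a, 'u) set_functor \<Rightarrow> ('o, 'a, 'u) set_functor \<Rightarrow> ('o \<Rightarrow> 'u \<Rightarrow> 'u) \<Rightarrow> bool" where
  "extension T A B i \<longleftrightarrow>
     model T A \<and> model T B \<and> is_nt T A B i \<and>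
     (\<forall>(X :: ('o, 'a, 'u) set_functor) Y f. full_map T X Y f \<longrightarrow> lifts T A B i X Y f)"

definition zero_extension ::
    "('o, 'a, 'm) clan_data_scheme \<Rightarrow> ('o, 'a, 'u) set_functor \<Rightarrow> bool" where
  "zero_extension T A \<longleftrightarrow> (\<exists>Z i. initial_model T Z \<and> extension T Z A i)"

section \<open>Categories of elements and flatness\<close>

text \<open>
  An arrow \<open>(x, a) \<rightarrow> (y, b)\<close> is an arrow \<open>s : y \<rightarrow> x\<close> of \<open>C\<close> taking \<open>b\<close> to \<open>a\<close>, stored together
  with its source and target.  The direction is reversed: the projection goes to the opposite of \<open>C\<close>.
\<close>

definition El ::
    "('o, 'a, 'm) cat_scheme \<Rightarrow> ('o, 'a, 'u) set_functor
      \<Rightarrow> ('o \<times> 'u, ('o \<times> 'u) \<times> 'a \<times> ('o \<times> 'u)) cat" where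
  "El C A = \<lparr>
     Ob = {(x, a). x \<in> Ob C \<and> a \<in> onOb A x},
     Ar = {((x, a), s, (y, b)). x \<in> Ob C \<and> a \<in> onOb A x \<and> y \<in> Ob C \<and> b \<in> onOb A y \<and>
             s \<in> hom C y x \<and> onAr A s b = a},
     src = (\<lambda>(e, s, e'). e),
     trg = (\<lambda>(e, s, e'). e'),
     idn = (\<lambda>(x, a). ((x, a), idn C x, (x, a))),
     cmp = (\<lambda>(_, r, e'') (e, s, _). (e, s \<cdot>\<^bsub>C\<^esub> r, e''))\<rparr>"

definition flat ::
    "('o, 'a, 'm) clan_data_scheme \<Rightarrow> ('o, 'a, 'u) set_functor \<Rightarrow> bool" where
  "flat T A \<longleftrightarrow> model T A \<and> filtered (El T A)"

section \<open>Sanity checks\<close>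

lemma El_category:
  assumes "category C" "is_functor C A"
  shows "category (El C A)"
proof -
  interpret category C by fact
  show ?thesis
  proof
    fix x assume "x \<in> Ob (El C A)"
    then show "idn (El C A) x \<in> hom (El C A) x x"
      using assms(2) idn_hom by (auto simp: El_def hom_def is_functor_def)
  next
    fix g y z f x assume "g \<in> hom (El C A) y z" "f \<in> hom (El C A) x y"
    then show "g \<cdot>\<^bsub>El C A\<^esub> f \<in> hom (El C A) x z"
      using assms(2) cmp_hom by (fastforce simp: El_def hom_def is_functor_def)
  qed (use idn_left idn_right cmp_assoc in \<open>auto simp: El_def hom_def\<close>)
qed

lemma repr_model:
  assumes "clan T" "x \<in> Ob T"
  shows "model T (repr T x)"
proof -
  interpret clan T by fact
  have "is_functor T (repr T x)"
    unfolding is_functor_def repr_def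
    using cmp_hom idn_left cmp_assoc by (auto simp: hom_def)
  moreover have "bij_betw (\<lambda>w. (p' \<cdot>\<^bsub>T\<^esub> w, q \<cdot>\<^bsub>T\<^esub> w)) (hom T x (src T p'))
      {(y, z). y \<in> hom T x (src T f) \<and> z \<in> hom T x (src T p) \<and> f \<cdot>\<^bsub>T\<^esub> y = p \<cdot>\<^bsub>T\<^esub> z}"
    if pb: "is_pullback T f p p' q" for f p p' q
  proof -
    have h: "f \<in> hom T (src T f) (trg T f)" "p \<in> hom T (src T p) (trg T f)"
      "p' \<in> hom T (src T p') (src T f)" "q \<in> hom T (src T p') (src T p)"
      and c: "f \<cdot>\<^bsub>T\<^esub> p' = p \<cdot>\<^bsub>T\<^esub> q"
      using pb by (auto simp: is_pullback_def hom_def)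
    have m: "p' \<cdot>\<^bsub>T\<^esub> w \<in> hom T x (src T f)" "q \<cdot>\<^bsub>T\<^esub> w \<in> hom T x (src T p)"
      "f \<cdot>\<^bsub>T\<^esub> (p' \<cdot>\<^bsub>T\<^esub> w) = p \<cdot>\<^bsub>T\<^esub> (q \<cdot>\<^bsub>T\<^esub> w)"
      if "w \<in> hom T x (src T p')" for w
      using cmp_hom[OF h(3) that] cmp_hom[OF h(4) that]
        cmp_assoc[OF h(1) h(3) that] cmp_assoc[OF h(2) h(4) that] c by auto
    have u: "\<exists>!w. w \<in> hom T x (src T p') \<and> p' \<cdot>\<^bsub>T\<^esub> w = y \<and> q \<cdot>\<^bsub>T\<^esub> w = z"
      if "y \<in> hom T x (src T f)" "z \<in> hom T x (src T p)" "f \<cdot>\<^bsub>T\<^esub> y = p \<cdot>\<^bsub>T\<^esub> z" for y z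
      using pb that assms(2) unfolding is_pullback_def by blast
    show ?thesis
      unfolding bij_betw_def
    proof
      show "inj_on (\<lambda>w. (p' \<cdot>\<^bsub>T\<^esub> w, q \<cdot>\<^bsub>T\<^esub> w)) (hom T x (src T p'))"
        using u[OF m] by (intro inj_onI) blast
      show "(\<lambda>w. (p' \<cdot>\<^bsub>T\<^esub> w, q \<cdot>\<^bsub>T\<^esub> w)) ` hom T x (src T p') =
        {(y, z). y \<in> hom T x (src T f) \<and> z \<in> hom T x (src T p) \<and> f \<cdot>\<^bsub>T\<^esub> y = p \<cdot>\<^bsub>T\<^esub> z}"
        using u m by (auto simp: image_iff) metis
    qed
  qed
  ultimately show ?thesis
    using assms(2) unfolding model_def by (auto simp: repr_def terminal_def)
qed

end

theory Submission
  imports Defs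
begin

text \<open>
  The idea is a fat small object argument.  For a model \<open>A\<close>, adjoin to the initial model a generator
  for every instance of the lifting problem that a full map to \<open>A\<close> has to solve, where the instances
  may involve generators adjoined before.  Each generator depends on finitely many others, so the
  result \<open>F\<close> is the colimit of the representables of the contexts spanned by finite dependency-closed
  sets of generators, and this colimit is directed.  The map \<open>F \<rightarrow> A\<close> is full, hence has a section if
  \<open>A\<close> is a 0-extension.  Two elements of \<open>A\<close>, or a parallel pair of arrows in its category of
  elements, can then be moved along the section to a stage of the colimit, where the required cocone
  exists, and back.
\<close>

section \<open>Functors and models\<close>

lemma functor_app:
  "\<lbrakk>is_functor C M; f \<in> hom C x y; a \<in> onOb M x\<rbrakk> \<Longrightarrow> onAr M f a \<in> onOb M y"
  by (auto simp: is_functor_def hom_def)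

lemma functor_cmp:
  "\<lbrakk>is_functor C M; g \<in> hom C y z; f \<in> hom C x y; a \<in> onOb M x\<rbrakk>
    \<Longrightarrow> onAr M (g \<cdot>\<^bsub>C\<^esub> f) a = onAr M g (onAr M f a)"
  by (auto simp: is_functor_def hom_def)

lemma model_functor: "model T M \<Longrightarrow> is_functor T M"
  by (simp add: model_def)

lemma model_terminal: "\<lbrakk>model T M; terminal T t\<rbrakk> \<Longrightarrow> \<exists>!a. a \<in> onOb M t"
  by (simp add: model_def)

lemma model_pullback:
  assumes "model T M" "p \<in> Disp T" "is_pullback T f p p' q"
    and "y \<in> onOb M (src T f)" "z \<in> onOb M (src T p)" "onAr M f y = onAr M p z"
  shows "\<exists>!w. w \<in> onOb M (src T p') \<and> onAr M p' w = y \<and> onAr M q w = z"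
proof -
  have b: "bij_betw (\<lambda>w. (onAr M p' w, onAr M q w)) (onOb M (src T p'))
      {(y, z). y \<in> onOb M (src T f) \<and> z \<in> onOb M (src T p) \<and> onAr M f y = onAr M p z}"
    using assms(1-3) unfolding model_def by blast
  have "(y, z) \<in> (\<lambda>w. (onAr M p' w, onAr M q w)) ` onOb M (src T p')"
    using bij_betw_imp_surj_on[OF b] assms(4-6) by simp
  then obtain w where "w \<in> onOb M (src T p')" "onAr M p' w = y" "onAr M q w = z" by auto
  with bij_betw_imp_inj_on[OF b] show ?thesis by (auto simp: inj_on_def)
qed

lemma nt_app: "\<lbrakk>is_nt C M N t; x \<in> Ob C; a \<in> onOb M x\<rbrakk> \<Longrightarrow> t x a \<in> onOb N x"
  by (auto simp: is_nt_def)

lemma nt_natural: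
  "\<lbrakk>is_nt C M N t; f \<in> hom C x y; a \<in> onOb M x\<rbrakk> \<Longrightarrow> t y (onAr M f a) = onAr N f (t x a)"
  by (auto simp: is_nt_def hom_def)

lemma nt_cmp_nt:
  assumes "category C" "is_nt C L M s" "is_nt C M N t"
  shows "is_nt C L N (nt_cmp t s)"
  using assms category.src_Ob[OF assms(1)] unfolding is_nt_def nt_cmp_def
  by (auto simp: Pi_iff)

lemma nt_idn: "is_nt C M M (\<lambda>x a. a)"
  by (auto simp: is_nt_def)

context category
begin

lemma hom_src: "f \<in> hom C x y \<Longrightarrow> src C f = x"
  and hom_trg: "f \<in> hom C x y \<Longrightarrow> trg C f = y"
  and hom_Ar: "f \<in> hom C x y \<Longrightarrow> f \<in> Ar C"
  by (auto simp: hom_def)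

lemma Ar_hom: "f \<in> Ar C \<Longrightarrow> f \<in> hom C (src C f) (trg C f)"
  by (auto simp: hom_def)

lemma hom_Ob: "f \<in> hom C x y \<Longrightarrow> x \<in> Ob C" "f \<in> hom C x y \<Longrightarrow> y \<in> Ob C"
  using src_Ob trg_Ob by (auto simp: hom_def)

end

lemma is_pullbackD:
  assumes "is_pullback C f p p' q"
  shows "f \<in> hom C (src C f) (trg C p)" "p \<in> hom C (src C p) (trg C p)"
    "p' \<in> hom C (src C p') (src C f)" "q \<in> hom C (src C p') (src C p)"
    "f \<cdot>\<^bsub>C\<^esub> p' = p \<cdot>\<^bsub>C\<^esub> q"
  using assms by (auto simp: is_pullback_def hom_def)

lemma is_pullback_univ:
  assumes "is_pullback C f p p' q" "x \<in> Ob C" "u \<in> hom C x (src C f)" "v \<in> hom C x (src C p)"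
    "f \<cdot>\<^bsub>C\<^esub> u = p \<cdot>\<^bsub>C\<^esub> v"
  shows "\<exists>!w. w \<in> hom C x (src C p') \<and> p' \<cdot>\<^bsub>C\<^esub> w = u \<and> q \<cdot>\<^bsub>C\<^esub> w = v"
  using assms unfolding is_pullback_def by blast

text \<open>By Yoneda, fullness means that the naturality squares at display maps are weak pullbacks.\<close>

lemma full_mapI:
  assumes T: "clan T" and M: "model T M" and N: "model T N" and r: "is_nt T M N r"
    and lift: "\<And>p x y. \<lbrakk>p \<in> Disp T; x \<in> onOb M (trg T p); y \<in> onOb N (src T p);
        r (trg T p) x = onAr N p y\<rbrakk>
      \<Longrightarrow> \<exists>x' \<in> onOb M (src T p). onAr M p x' = x \<and> r (src T p) x' = y"
  shows "full_map T M N r"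
  unfolding full_map_def
proof (intro conjI ballI M N r)
  interpret clan T by fact
  note fM = model_functor[OF M]
  fix p assume p: "p \<in> Disp T"
  let ?x = "src T p" and ?y = "trg T p"
  have ph: "p \<in> hom T ?x ?y" using p Disp_Ar Ar_hom by blast
  note ob = hom_Ob[OF ph]
  show "lifts T (repr T ?y) (repr T ?x) (repr_map T p) M N r"
    unfolding lifts_def
  proof (intro allI impI)
    fix u v
    assume u: "is_nt T (repr T ?y) M u" and v: "is_nt T (repr T ?x) N v"
      and uv: "nt_eq T (repr T ?y) (nt_cmp r u) (nt_cmp v (repr_map T p))"
    have iy: "idn T ?y \<in> onOb (repr T ?y) ?y" and ix: "idn T ?x \<in> onOb (repr T ?x) ?x"
      using idn_hom ob by (auto simp: repr_def)
    \<comment> \<open>By Yoneda, \<open>u\<close> and \<open>v\<close> amount to the elements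
      \<open>a\<close> and \<open>b\<close>, and commutativity of the square becomes the single
      equation \<open>r ?y a = onAr N p b\<close>.\<close>
    define a b where "a = u ?y (idn T ?y)" and "b = v ?x (idn T ?x)"
    have a: "a \<in> onOb M ?y" and b: "b \<in> onOb N ?x"
      unfolding a_def b_def using nt_app[OF u] nt_app[OF v] iy ix ob by auto
    have u_eq: "u z g = onAr M g a" if "g \<in> hom T ?y z" for z g
      using nt_natural[OF u that iy] idn_right[OF that] by (simp add: a_def repr_def)
    have v_eq: "v z g = onAr N g b" if "g \<in> hom T ?x z" for z g
      using nt_natural[OF v that ix] idn_right[OF that] by (simp add: b_def repr_def)
    have "r ?y a = v ?y (idn T ?y \<cdot>\<^bsub>T\<^esub> p)"
      using uv ob iy by (simp add: nt_eq_def nt_cmp_def repr_map_def a_def)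
    then have "r ?y a = onAr N p b"
      using v_eq ph idn_left[OF ph] by simp
    from lift[OF p a b this] obtain c
      where c: "c \<in> onOb M ?x" "onAr M p c = a" "r ?x c = b" by blast
    let ?h = "\<lambda>(_ :: 'a) g. onAr M g c"
    have "is_nt T (repr T ?x) M ?h"
      unfolding is_nt_def
    proof (intro conjI ballI funcsetI)
      fix z g assume "z \<in> Ob T" "g \<in> onOb (repr T ?x) z"
      then show "?h z g \<in> onOb M z" using functor_app[OF fM] c by (auto simp: repr_def)
    next
      fix f g assume "f \<in> Ar T" "g \<in> onOb (repr T ?x) (src T f)"
      then show "?h (trg T f) (onAr (repr T ?x) f g) = onAr M f (?h (src T f) g)"
        using functor_cmp[OF fM Ar_hom] c by (auto simp: repr_def)
    qed
    moreover have "nt_eq T (repr T ?y) (nt_cmp ?h (repr_map T p)) u"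
      using functor_cmp[OF fM _ ph c(1)] u_eq c(2)
      by (auto simp: nt_eq_def nt_cmp_def repr_map_def repr_def)
    moreover have "nt_eq T (repr T ?x) (nt_cmp r ?h) v"
      using nt_natural[OF r _ c(1)] v_eq c(3)
      by (auto simp: nt_eq_def nt_cmp_def repr_def)
    ultimately show "\<exists>h. is_nt T (repr T ?x) M h \<and> nt_eq T (repr T ?y) (nt_cmp h (repr_map T p)) u \<and>
        nt_eq T (repr T ?x) (nt_cmp r h) v" by blast
  qed
qed

text \<open>The section is a lift of the identity of \<open>A\<close> against the full map
  \<open>r\<close>. The square to be filled starts at the initial model, so it commutes by
  uniqueness of maps out of it.\<close>

lemma zero_extension_section:
  assumes T: "clan T" and A: "zero_extension T A" and r: "full_map T F A r"
  shows "\<exists>s. is_nt T A F s \<and> nt_eq T A (nt_cmp r s) (\<lambda>x a. a)"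
proof -
  interpret clan T by fact
  have F: "model T F" "model T A" "is_nt T F A r" using r by (auto simp: full_map_def)
  obtain Z i where Z: "initial_model T Z" and i: "extension T Z A i"
    using A by (auto simp: zero_extension_def)
  obtain u where u: "is_nt T Z F u" using Z F by (auto simp: initial_model_def)
  have "is_nt T Z A (nt_cmp r u)" by (rule nt_cmp_nt[OF category_axioms u F(3)])
  moreover have "is_nt T Z A i" using i by (simp add: extension_def)
  moreover obtain t where "\<And>t'. is_nt T Z A t' \<Longrightarrow> nt_eq T Z t' t"
    using Z F(2) unfolding initial_model_def by blast
  ultimately have "nt_eq T Z (nt_cmp r u) t" "nt_eq T Z i t" by blast+
  then have "nt_eq T Z (nt_cmp r u) (nt_cmp (\<lambda>x a. a) i)"
    by (simp add: nt_eq_def nt_cmp_def)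
  moreover have "lifts T Z A i F A r" using i r by (auto simp: extension_def)
  ultimately show ?thesis
    using u nt_idn unfolding lifts_def by blast
qed

section \<open>Directed colimits of representables\<close>

text \<open>
  A directed diagram in the category of elements of \<open>A\<close>.  The injection \<open>code\<close> brings the elements
  of the colimit into the universe.
\<close>

locale element_diagram = clan T for T :: "('o, 'a, 'm) clan_data_scheme" (structure) +
  fixes A :: "('o, 'a, 'u) set_functor"
    and I :: "'i set" and le :: "'i \<Rightarrow> 'i \<Rightarrow> bool"
    and G :: "'i \<Rightarrow> 'o" and proj :: "'i \<Rightarrow> 'i \<Rightarrow> 'a" and \<alpha> :: "'i \<Rightarrow> 'u"
    and code :: "'i \<times> 'a \<Rightarrow> 'u"
  assumes model_A: "model T A"
    and I_nonempty: "I \<noteq> {}"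
    and directed: "\<lbrakk>i \<in> I; j \<in> I\<rbrakk> \<Longrightarrow> \<exists>k \<in> I. le i k \<and> le j k"
    and le_trans: "\<lbrakk>i \<in> I; j \<in> I; k \<in> I; le i j; le j k\<rbrakk> \<Longrightarrow> le i k"
    and G_Ob: "i \<in> I \<Longrightarrow> G i \<in> Ob T"
    and proj_hom: "\<lbrakk>i \<in> I; j \<in> I; le i j\<rbrakk> \<Longrightarrow> proj j i \<in> hom T (G j) (G i)"
    and proj_cmp: "\<lbrakk>i \<in> I; j \<in> I; k \<in> I; le i j; le j k\<rbrakk> \<Longrightarrow> proj j i \<cdot> proj k j = proj k i"
    and \<alpha>_Ob: "i \<in> I \<Longrightarrow> \<alpha> i \<in> onOb A (G i)"
    and \<alpha>_proj: "\<lbrakk>i \<in> I; j \<in> I; le i j\<rbrakk> \<Longrightarrow> onAr A (proj j i) (\<alpha> j) = \<alpha> i"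
    and code_inj: "inj_on code (I \<times> Ar T)"
begin

section \<open>Germs: the elements of the colimit\<close>

lemmas functor_A = model_functor[OF model_A]

text \<open>This is the usual identification in the directed colimit of the sets of arrows
  \<open>G i\<close> to \<open>x\<close>, for all \<open>x\<close> at once. The transition maps
  precompose with \<open>proj j i\<close>, which runs from the later stage \<open>j\<close> back to
  \<open>i\<close>.\<close>

definition germ_eq :: "'i \<times> 'a \<Rightarrow> 'i \<times> 'a \<Rightarrow> bool" where
  "germ_eq = (\<lambda>(i, t) (j, s). i \<in> I \<and> j \<in> I \<and>
     (\<exists>x. t \<in> hom T (G i) x \<and> s \<in> hom T (G j) x) \<and> (\<exists>k \<in> I. le i k \<and> le j k \<and> t \<cdot> proj k i = s \<cdot> proj k j))"

text \<open>An equivalence class is a set and does not live in the universe, so the code of a chosen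
  member stands for it.\<close>

definition germ :: "'i \<Rightarrow> 'a \<Rightarrow> 'u" where
  "germ i t = code (SOME x. germ_eq (i, t) x)"

lemma cmp_proj:
  assumes "i \<in> I" "j \<in> I" "k \<in> I" "le i j" "le j k" "t \<in> hom T (G i) x"
  shows "(t \<cdot> proj j i) \<cdot> proj k j = t \<cdot> proj k i"
  using assms cmp_assoc[OF assms(6) proj_hom proj_hom] proj_cmp by simp

lemma germ_eq_refl:
  assumes "i \<in> I" "t \<in> hom T (G i) x"
  shows "germ_eq (i, t) (i, t)"
  using assms directed[OF assms(1) assms(1)] by (auto simp: germ_eq_def)

lemma germ_eq_sym: "germ_eq a b \<Longrightarrow> germ_eq b a"
  unfolding germ_eq_def by (auto split: prod.splits)

lemma germ_eq_trans:
  assumes "germ_eq a b" "germ_eq b c"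
  shows "germ_eq a c"
proof -
  obtain i t j s l u where [simp]: "a = (i, t)" "b = (j, s)" "c = (l, u)"
    by (cases a, cases b, cases c) blast
  have I: "i \<in> I" "j \<in> I" "l \<in> I"
    using assms by (auto simp: germ_eq_def)
  obtain x y where t: "t \<in> hom T (G i) x" and s: "s \<in> hom T (G j) x"
    and s': "s \<in> hom T (G j) y" and u: "u \<in> hom T (G l) y"
    using assms by (auto simp: germ_eq_def)
  have "y = x" using hom_trg[OF s] hom_trg[OF s'] by simp
  note u = u[unfolded this]
  obtain k where k: "k \<in> I" "le i k" "le j k" "t \<cdot> proj k i = s \<cdot> proj k j"
    using assms(1) by (auto simp: germ_eq_def)
  obtain k' where k': "k' \<in> I" "le j k'" "le l k'" "s \<cdot> proj k' j = u \<cdot> proj k' l"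
    using assms(2) by (auto simp: germ_eq_def)
  obtain n where n: "n \<in> I" "le k n" "le k' n" using directed k(1) k'(1) by blast
  have "t \<cdot> proj n i = u \<cdot> proj n l"
    using cmp_proj[OF I(1) k(1) n(1) k(2) n(2) t] cmp_proj[OF I(2) k(1) n(1) k(3) n(2) s]
      cmp_proj[OF I(2) k'(1) n(1) k'(2) n(3) s] cmp_proj[OF I(3) k'(1) n(1) k'(3) n(3) u]
      k(4) k'(4) by simp
  moreover have "le i n" "le l n"
    using le_trans I k k' n by blast+
  ultimately show ?thesis using I t u n by (auto simp: germ_eq_def)
qed

lemma germ_eq_iff:
  assumes "i \<in> I" "j \<in> I" "t \<in> hom T (G i) x" "s \<in> hom T (G j) x"
  shows "germ i t = germ j s \<longleftrightarrow> (\<exists>k \<in> I. le i k \<and> le j k \<and> t \<cdot> proj k i = s \<cdot> proj k j)"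
    (is "_ \<longleftrightarrow> ?R")
proof -
  let ?a = "SOME x. germ_eq (i, t) x" and ?b = "SOME x. germ_eq (j, s) x"
  have a: "germ_eq (i, t) ?a" and b: "germ_eq (j, s) ?b"
    using germ_eq_refl assms by (blast intro: someI)+
  have R: "?R \<longleftrightarrow> germ_eq (i, t) (j, s)"
    using assms by (auto simp: germ_eq_def)
  show ?thesis
  proof
    have *: "y \<in> I \<times> Ar T" if "germ_eq x y" for x y
      using that hom_Ar by (auto simp: germ_eq_def)
    assume "germ i t = germ j s"
    then have "?a = ?b"
      unfolding germ_def using inj_onD[OF code_inj _ *[OF a] *[OF b]] by blast
    with b have "germ_eq (j, s) ?a" by simp
    then show ?R unfolding R by (rule germ_eq_trans[OF a germ_eq_sym])
  next
    assume ?R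
    then have "germ_eq (i, t) (j, s)" by (simp only: R)
    \<comment> \<open>Equivalent pairs define the same predicate, so the choice in
      \<open>germ\<close> picks the same member for both.\<close>
    then have "germ_eq (i, t) = germ_eq (j, s)"
      using germ_eq_trans germ_eq_sym by blast
    then show "germ i t = germ j s" by (simp add: germ_def)
  qed
qed

lemma germ_proj:
  assumes "i \<in> I" "j \<in> I" "le i j" "t \<in> hom T (G i) x"
  shows "germ j (t \<cdot> proj j i) = germ i t"
proof -
  obtain k where k: "k \<in> I" "le j k" using directed assms by blast
  have "le i k" by (rule le_trans[OF assms(1,2) k(1) assms(3) k(2)])
  moreover have "(t \<cdot> proj j i) \<cdot> proj k j = t \<cdot> proj k i"
    by (rule cmp_proj[OF assms(1,2) k(1) assms(3) k(2) assms(4)])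
  ultimately show ?thesis
    unfolding germ_eq_iff[OF assms(2,1) cmp_hom[OF assms(4) proj_hom[OF assms(1-3)]] assms(4)]
    using k by blast
qed

section \<open>The colimit as a functor and its map to \<open>A\<close>\<close>

definition rep :: "'o \<Rightarrow> 'u \<Rightarrow> 'i \<times> 'a" where
  "rep x a = (SOME (i, t). i \<in> I \<and> t \<in> hom T (G i) x \<and> germ i t = a)"

text \<open>The action must be a function on bare elements of the universe, so it first recovers a
  representative through \<open>rep\<close>. Independence of that choice is the content of
  \<open>colim_Ar\<close>, and of \<open>aug_germ\<close> for the map \<open>aug\<close>.\<close>

definition colim :: "('o, 'a, 'u) set_functor" where
  "colim = \<lparr>onOb = (\<lambda>x. {germ i t | i t. i \<in> I \<and> t \<in> hom T (G i) x}),
     onAr = (\<lambda>g a. case rep (src T g) a of (i, t) \<Rightarrow> germ i (g \<cdot> t))\<rparr>"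

definition aug :: "'o \<Rightarrow> 'u \<Rightarrow> 'u" where
  "aug x a = (case rep x a of (i, t) \<Rightarrow> onAr A t (\<alpha> i))"

lemma rep_germ:
  assumes "i \<in> I" "t \<in> hom T (G i) x"
  obtains j s where "rep x (germ i t) = (j, s)" "j \<in> I" "s \<in> hom T (G j) x" "germ j s = germ i t"
proof -
  let ?P = "\<lambda>(j, s). j \<in> I \<and> s \<in> hom T (G j) x \<and> germ j s = germ i t"
  have "?P (rep x (germ i t))"
    unfolding rep_def by (rule someI[of ?P "(i, t)"]) (use assms in simp)
  then show thesis using that by (auto split: prod.splits)
qed

lemma colim_Ob: "onOb colim x = {germ i t | i t. i \<in> I \<and> t \<in> hom T (G i) x}"
  by (simp add: colim_def)

lemma germ_Ob: "\<lbrakk>i \<in> I; t \<in> hom T (G i) x\<rbrakk> \<Longrightarrow> germ i t \<in> onOb colim x"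
  by (auto simp: colim_def)

lemma colim_Ar:
  assumes "i \<in> I" "t \<in> hom T (G i) x" "g \<in> hom T x y"
  shows "onAr colim g (germ i t) = germ i (g \<cdot> t)"
proof -
  obtain j s where r: "rep x (germ i t) = (j, s)" "j \<in> I" "s \<in> hom T (G j) x" "germ j s = germ i t"
    using rep_germ assms by metis
  then obtain k where k: "k \<in> I" "le j k" "le i k" "s \<cdot> proj k j = t \<cdot> proj k i"
    using germ_eq_iff[OF r(2) assms(1) r(3) assms(2)] by blast
  then have "(g \<cdot> s) \<cdot> proj k j = (g \<cdot> t) \<cdot> proj k i"
    using cmp_assoc[OF assms(3) r(3) proj_hom] cmp_assoc[OF assms(3,2) proj_hom] r assms by simp
  then have "germ j (g \<cdot> s) = germ i (g \<cdot> t)"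
    using germ_eq_iff[OF r(2) assms(1) cmp_hom[OF assms(3) r(3)] cmp_hom[OF assms(3,2)]] k by blast
  with r hom_src[OF assms(3)] show ?thesis by (simp add: colim_def)
qed

lemma \<alpha>_cmp_proj:
  assumes "i \<in> I" "j \<in> I" "le i j" "t \<in> hom T (G i) x"
  shows "onAr A (t \<cdot> proj j i) (\<alpha> j) = onAr A t (\<alpha> i)"
  using functor_cmp[OF functor_A assms(4) proj_hom \<alpha>_Ob] \<alpha>_proj assms by simp

lemma aug_germ:
  assumes "i \<in> I" "t \<in> hom T (G i) x"
  shows "aug x (germ i t) = onAr A t (\<alpha> i)"
proof -
  obtain j s where r: "rep x (germ i t) = (j, s)" "j \<in> I" "s \<in> hom T (G j) x" "germ j s = germ i t"
    using rep_germ assms by metis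
  then obtain k where k: "k \<in> I" "le j k" "le i k" "s \<cdot> proj k j = t \<cdot> proj k i"
    using germ_eq_iff[OF r(2) assms(1) r(3) assms(2)] by blast
  then have "onAr A s (\<alpha> j) = onAr A t (\<alpha> i)"
    using \<alpha>_cmp_proj[OF r(2) k(1,2) r(3)] \<alpha>_cmp_proj[OF assms(1) k(1,3) assms(2)] by simp
  with r show ?thesis by (simp add: aug_def)
qed

lemma colim_functor: "is_functor T colim"
  unfolding is_functor_def
proof (intro conjI ballI impI funcsetI)
  fix f a assume f: "f \<in> Ar T" and "a \<in> onOb colim (src T f)"
  then obtain i t where "i \<in> I" "t \<in> hom T (G i) (src T f)" "a = germ i t"
    by (auto simp: colim_Ob)
  then show "onAr colim f a \<in> onOb colim (trg T f)"
    using colim_Ar[OF _ _ Ar_hom[OF f]] germ_Ob cmp_hom[OF Ar_hom[OF f]] by simp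
next
  fix x a assume x: "x \<in> Ob T" and "a \<in> onOb colim x"
  then obtain i t where "i \<in> I" "t \<in> hom T (G i) x" "a = germ i t"
    by (auto simp: colim_Ob)
  then show "onAr colim (idn T x) a = a"
    using colim_Ar[OF _ _ idn_hom[OF x]] idn_left by simp
next
  fix f g a assume f: "f \<in> Ar T" and g: "g \<in> Ar T" "src T g = trg T f"
    and "a \<in> onOb colim (src T f)"
  then obtain i t where i: "i \<in> I" "a = germ i t" and t: "t \<in> hom T (G i) (src T f)"
    by (auto simp: colim_Ob)
  have fh: "f \<in> hom T (src T f) (trg T f)" and gh: "g \<in> hom T (trg T f) (trg T g)"
    using Ar_hom[OF f] Ar_hom[OF g(1)] g(2) by simp_all
  show "onAr colim (g \<cdot> f) a = onAr colim g (onAr colim f a)"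
    using colim_Ar[OF i(1) t cmp_hom[OF gh fh]] colim_Ar[OF i(1) t fh]
      colim_Ar[OF i(1) cmp_hom[OF fh t] gh] cmp_assoc[OF gh fh t] i by simp
qed

section \<open>The colimit is a model\<close>

lemma common_stage:
  assumes "a \<in> onOb colim x" "b \<in> onOb colim y"
  obtains k t s where "k \<in> I" "t \<in> hom T (G k) x" "s \<in> hom T (G k) y" "a = germ k t" "b = germ k s"
proof -
  obtain i t j s where i: "i \<in> I" "t \<in> hom T (G i) x" "a = germ i t"
    and j: "j \<in> I" "s \<in> hom T (G j) y" "b = germ j s"
    using assms by (auto simp: colim_Ob)
  obtain k where k: "k \<in> I" "le i k" "le j k" using directed i j by blast
  show thesis
  proof (rule that[OF k(1)])
    show "t \<cdot> proj k i \<in> hom T (G k) x" "s \<cdot> proj k j \<in> hom T (G k) y"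
      using cmp_hom proj_hom i j k by blast+
    show "a = germ k (t \<cdot> proj k i)" "b = germ k (s \<cdot> proj k j)"
      using germ_proj i j k by metis+
  qed
qed

lemma germ_eqE:
  assumes "germ k t = germ k s" "k \<in> I" "t \<in> hom T (G k) x" "s \<in> hom T (G k) x"
  obtains l where "l \<in> I" "le k l" "t \<cdot> proj l k = s \<cdot> proj l k"
  using assms germ_eq_iff by blast

text \<open>Representables preserve all limits, and directed colimits of sets commute with finite
  ones. Concretely, the finitely many elements and equations involved already live at one stage,
  where the universal property in \<open>T\<close> applies.\<close>

lemma colim_model: "model T colim"
  unfolding model_def
proof (intro conjI allI impI colim_functor)
  fix x assume x: "terminal T x"
  obtain i where i: "i \<in> I" using I_nonempty by blast
  then obtain t where "t \<in> hom T (G i) x" using x G_Ob unfolding terminal_def by blast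
  then have "germ i t \<in> onOb colim x" using germ_Ob i by blast
  moreover have "a = b" if ab: "a \<in> onOb colim x" "b \<in> onOb colim x" for a b
  proof -
    obtain k t s where "k \<in> I" "t \<in> hom T (G k) x" "s \<in> hom T (G k) x" "a = germ k t" "b = germ k s"
      using common_stage[OF ab] .
    with x G_Ob show ?thesis unfolding terminal_def by blast
  qed
  ultimately show "\<exists>!a. a \<in> onOb colim x" by blast
next
  fix f p p' q assume p: "p \<in> Disp T" and pb: "is_pullback T f p p' q"
  note h = is_pullbackD[OF pb]
  let ?m = "\<lambda>w. (onAr colim p' w, onAr colim q w)"
  show "bij_betw ?m (onOb colim (src T p'))
    {(y, z). y \<in> onOb colim (src T f) \<and> z \<in> onOb colim (src T p) \<and> onAr colim f y = onAr colim p z}"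
    (is "bij_betw _ _ ?P")
    unfolding bij_betw_def
  proof (intro conjI inj_onI)
    fix a b assume ab: "a \<in> onOb colim (src T p')" "b \<in> onOb colim (src T p')" and m: "?m a = ?m b"
    obtain k t s where k: "k \<in> I" "t \<in> hom T (G k) (src T p')" "s \<in> hom T (G k) (src T p')"
      and ab: "a = germ k t" "b = germ k s"
      using common_stage[OF ab] .
    have "germ k (p' \<cdot> t) = germ k (p' \<cdot> s)" "germ k (q \<cdot> t) = germ k (q \<cdot> s)"
      using m ab colim_Ar[OF k(1,2) h(3)] colim_Ar[OF k(1,3) h(3)]
        colim_Ar[OF k(1,2) h(4)] colim_Ar[OF k(1,3) h(4)] by simp_all
    then obtain l l' where l: "l \<in> I" "le k l" "(p' \<cdot> t) \<cdot> proj l k = (p' \<cdot> s) \<cdot> proj l k"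
      and l': "l' \<in> I" "le k l'" "(q \<cdot> t) \<cdot> proj l' k = (q \<cdot> s) \<cdot> proj l' k"
      using germ_eqE k cmp_hom[OF h(3)] cmp_hom[OF h(4)] by metis
    \<comment> \<open>The two coordinates become equal at possibly different stages \<open>l\<close>
      and \<open>l'\<close>; both equations hold at \<open>n\<close>.\<close>
    obtain n where n: "n \<in> I" "le l n" "le l' n" using directed l l' by blast
    have kn: "le k n" using le_trans k l n by blast
    note \<pi> = proj_hom[OF k(1) n(1) kn]
    have tn: "t \<cdot> proj n k \<in> hom T (G n) (src T p')" and sn: "s \<cdot> proj n k \<in> hom T (G n) (src T p')"
      using cmp_hom k \<pi> by blast+
    have "(p' \<cdot> t) \<cdot> proj n k = (p' \<cdot> s) \<cdot> proj n k"
      using cmp_proj[OF k(1) l(1) n(1) l(2) n(2) cmp_hom[OF h(3) k(2)]]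
        cmp_proj[OF k(1) l(1) n(1) l(2) n(2) cmp_hom[OF h(3) k(3)]] l by simp
    then have e1: "p' \<cdot> (t \<cdot> proj n k) = p' \<cdot> (s \<cdot> proj n k)"
      using cmp_assoc[OF h(3) k(2) \<pi>] cmp_assoc[OF h(3) k(3) \<pi>] by simp
    have "(q \<cdot> t) \<cdot> proj n k = (q \<cdot> s) \<cdot> proj n k"
      using cmp_proj[OF k(1) l'(1) n(1) l'(2) n(3) cmp_hom[OF h(4) k(2)]]
        cmp_proj[OF k(1) l'(1) n(1) l'(2) n(3) cmp_hom[OF h(4) k(3)]] l' by simp
    then have e2: "q \<cdot> (t \<cdot> proj n k) = q \<cdot> (s \<cdot> proj n k)"
      using cmp_assoc[OF h(4) k(2) \<pi>] cmp_assoc[OF h(4) k(3) \<pi>] by simp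
    have e3: "f \<cdot> (p' \<cdot> (s \<cdot> proj n k)) = p \<cdot> (q \<cdot> (s \<cdot> proj n k))"
      using cmp_assoc[OF h(1,3) sn] cmp_assoc[OF h(2,4) sn] h(5) by simp
    have "t \<cdot> proj n k = s \<cdot> proj n k"
      using is_pullback_univ[OF pb G_Ob[OF n(1)] cmp_hom[OF h(3) sn] cmp_hom[OF h(4) sn] e3]
        tn sn e1 e2 by blast
    then show "a = b" using ab germ_proj k n kn by metis
  next
    show "?m ` onOb colim (src T p') = ?P"
    proof (intro equalityI subsetI)
      fix yz assume "yz \<in> ?m ` onOb colim (src T p')"
      then obtain w where w: "w \<in> onOb colim (src T p')" "yz = ?m w" by blast
      then show "yz \<in> ?P"
        using functor_app[OF colim_functor h(3)] functor_app[OF colim_functor h(4)]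
          functor_cmp[OF colim_functor h(1,3)] functor_cmp[OF colim_functor h(2,4)] h(5)
        by auto
    next
      fix yz assume "yz \<in> ?P"
      then obtain y z where yz: "yz = (y, z)" "y \<in> onOb colim (src T f)" "z \<in> onOb colim (src T p)"
        "onAr colim f y = onAr colim p z" by auto
      obtain k u v where k: "k \<in> I" "u \<in> hom T (G k) (src T f)" "v \<in> hom T (G k) (src T p)"
        and e: "y = germ k u" "z = germ k v"
        using common_stage[OF yz(2,3)] .
      have "germ k (f \<cdot> u) = germ k (p \<cdot> v)"
        using yz(4) e colim_Ar[OF k(1,2) h(1)] colim_Ar[OF k(1,3) h(2)] by simp
      \<comment> \<open>The representatives \<open>u\<close> and \<open>v\<close> form a cone only
        from some later stage \<open>l\<close> on; there the pullback supplies
        \<open>w\<close>.\<close>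
      then obtain l where l: "l \<in> I" "le k l" "(f \<cdot> u) \<cdot> proj l k = (p \<cdot> v) \<cdot> proj l k"
        using germ_eqE k cmp_hom[OF h(1) k(2)] cmp_hom[OF h(2) k(3)] by metis
      note \<pi> = proj_hom[OF k(1) l(1,2)]
      have "f \<cdot> (u \<cdot> proj l k) = p \<cdot> (v \<cdot> proj l k)"
        using cmp_assoc[OF h(1) k(2) \<pi>] cmp_assoc[OF h(2) k(3) \<pi>] l by simp
      from is_pullback_univ[OF pb G_Ob[OF l(1)] cmp_hom[OF k(2) \<pi>] cmp_hom[OF k(3) \<pi>] this]
      obtain w where w: "w \<in> hom T (G l) (src T p')" "p' \<cdot> w = u \<cdot> proj l k" "q \<cdot> w = v \<cdot> proj l k"
        by blast
      have "?m (germ l w) = yz"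
        using colim_Ar[OF l(1) w(1) h(3)] colim_Ar[OF l(1) w(1) h(4)] w
          germ_proj[OF k(1) l(1,2) k(2)] germ_proj[OF k(1) l(1,2) k(3)] yz e by simp
      then show "yz \<in> ?m ` onOb colim (src T p')" using germ_Ob[OF l(1) w(1)] by blast
    qed
  qed
qed

section \<open>Fullness of the map to \<open>A\<close>\<close>

lemma aug_nt: "is_nt T colim A aug"
  unfolding is_nt_def
proof (intro conjI ballI funcsetI)
  fix x a assume "a \<in> onOb colim x"
  then obtain i t where "i \<in> I" "t \<in> hom T (G i) x" "a = germ i t" by (auto simp: colim_Ob)
  then show "aug x a \<in> onOb A x" using aug_germ functor_app[OF functor_A] \<alpha>_Ob by auto
next
  fix f a assume f: "f \<in> Ar T" and "a \<in> onOb colim (src T f)"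
  then obtain i t where i: "i \<in> I" "t \<in> hom T (G i) (src T f)" "a = germ i t"
    by (auto simp: colim_Ob)
  note fh = Ar_hom[OF f]
  show "aug (trg T f) (onAr colim f a) = onAr A f (aug (src T f) a)"
    using colim_Ar[OF i(1,2) fh] aug_germ[OF i(1) cmp_hom[OF fh i(2)]] aug_germ[OF i(1,2)]
      functor_cmp[OF functor_A fh i(2) \<alpha>_Ob[OF i(1)]] i(3) by simp
qed

text \<open>The hypothesis solves only the problems posed over a stage \<open>G i\<close> and its
  point \<open>\<alpha> i\<close>. Any other problem reduces to one of these by pulling the display
  map back along a representative of the given germ.\<close>

lemma aug_full:
  assumes extend: "\<And>i p y. \<lbrakk>i \<in> I; p \<in> Disp T; trg T p = G i; y \<in> onOb A (src T p);
      onAr A p y = \<alpha> i\<rbrakk>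
    \<Longrightarrow> \<exists>j \<in> I. le i j \<and> (\<exists>e \<in> hom T (G j) (src T p). p \<cdot> e = proj j i \<and> onAr A e (\<alpha> j) = y)"
  shows "full_map T colim A aug"
proof (rule full_mapI[OF clan_axioms colim_model model_A aug_nt])
  fix p x y assume p: "p \<in> Disp T" and x: "x \<in> onOb colim (trg T p)"
    and y: "y \<in> onOb A (src T p)" and xy: "aug (trg T p) x = onAr A p y"
  obtain i t where i: "i \<in> I" and t: "t \<in> hom T (G i) (trg T p)" "x = germ i t"
    using x by (auto simp: colim_Ob)
  obtain p' q where pb: "is_pullback T t p p' q"
    using pullback_exists[OF p hom_Ar[OF t(1)] hom_trg[OF t(1)]] by blast
  note h = is_pullbackD[OF pb, unfolded hom_src[OF t(1)]]
  have "onAr A t (\<alpha> i) = onAr A p y" using aug_germ[OF i t(1)] t(2) xy by simp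
  \<comment> \<open>\<open>A\<close> preserves this pullback, so \<open>\<alpha> i\<close> and
    \<open>y\<close> glue to a point \<open>z\<close>, which poses a problem for the display map
    \<open>p'\<close> over the stage \<open>G i\<close>.\<close>
  then have "\<exists>!z. z \<in> onOb A (src T p') \<and> onAr A p' z = \<alpha> i \<and> onAr A q z = y"
    using \<alpha>_Ob[OF i] hom_src[OF t(1)] by (intro model_pullback[OF model_A p pb _ y]) simp_all
  then obtain z where z: "z \<in> onOb A (src T p')" "onAr A p' z = \<alpha> i" "onAr A q z = y"
    by blast
  obtain j e where j: "j \<in> I" "le i j" and e: "e \<in> hom T (G j) (src T p')"
    "p' \<cdot> e = proj j i" "onAr A e (\<alpha> j) = z"
    using extend[OF i pullback_Disp[OF p pb] hom_trg[OF h(3)] z(1,2)] by blast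
  note qe = cmp_hom[OF h(4) e(1)]
  have "p \<cdot> (q \<cdot> e) = t \<cdot> proj j i"
    using cmp_assoc[OF h(2,4) e(1)] cmp_assoc[OF h(1,3) e(1)] h(5) e(2) by simp
  then have "onAr colim p (germ j (q \<cdot> e)) = x"
    using colim_Ar[OF j(1) qe h(2)] germ_proj[OF i j t(1)] t(2) by simp
  moreover have "aug (src T p) (germ j (q \<cdot> e)) = y"
    using aug_germ[OF j(1) qe] functor_cmp[OF functor_A h(4) e(1) \<alpha>_Ob[OF j(1)]] e(3) z(3) by simp
  ultimately show "\<exists>x' \<in> onOb colim (src T p). onAr colim p x' = x \<and> aug (src T p) x' = y"
    using germ_Ob[OF j(1) qe] by blast
qed

text \<open>All cocones have a vertex of the form \<open>(G k, \<alpha> k)\<close>. A representative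
  of the germ \<open>s x a\<close> is an arrow from \<open>(x, a)\<close> to such a vertex, because
  \<open>aug\<close> evaluates it at \<open>\<alpha> k\<close> and undoes \<open>s\<close>.\<close>

lemma retract_flat:
  assumes s: "is_nt T A colim s" and rs: "nt_eq T A (nt_cmp aug s) (\<lambda>x a. a)"
  shows "flat T A"
proof -
  have aug_s: "aug x (s x a) = a" if "x \<in> Ob T" "a \<in> onOb A x" for x a
    using rs that by (simp add: nt_eq_def nt_cmp_def)
  have El_hom: "hom (El T A) (x, a) (y, b) = {((x, a), g, (y, b)) | g.
      x \<in> Ob T \<and> a \<in> onOb A x \<and> y \<in> Ob T \<and> b \<in> onOb A y \<and> g \<in> hom T y x \<and> onAr A g b = a}"
    for x a y b by (auto simp: hom_def El_def)
  have El_Ob: "Ob (El T A) = {(x, a). x \<in> Ob T \<and> a \<in> onOb A x}"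
    by (simp add: El_def)
  have stage: "(G k, \<alpha> k) \<in> Ob (El T A)" if "k \<in> I" for k
    using that G_Ob \<alpha>_Ob by (simp add: El_Ob)
  have "filtered (El T A)"
    unfolding filtered_def
  proof (intro conjI ballI)
    show "Ob (El T A) \<noteq> {}" using stage I_nonempty by blast
  next
    fix e e' assume "e \<in> Ob (El T A)" "e' \<in> Ob (El T A)"
    then obtain x a y b where e: "e = (x, a)" "e' = (y, b)"
      and x: "x \<in> Ob T" "a \<in> onOb A x" and y: "y \<in> Ob T" "b \<in> onOb A y"
      by (auto simp: El_Ob)
    obtain k t u where k: "k \<in> I" and t: "t \<in> hom T (G k) x" "s x a = germ k t"
      and u: "u \<in> hom T (G k) y" "s y b = germ k u"
      using common_stage[OF nt_app[OF s x] nt_app[OF s y]] .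
    have "onAr A t (\<alpha> k) = a" "onAr A u (\<alpha> k) = b"
      using aug_germ[OF k t(1)] aug_germ[OF k u(1)] t(2) u(2) aug_s[OF x] aug_s[OF y]
      by simp_all
    then have "hom (El T A) e (G k, \<alpha> k) \<noteq> {}" "hom (El T A) e' (G k, \<alpha> k) \<noteq> {}"
      using e x y t u G_Ob[OF k] \<alpha>_Ob[OF k] by (auto simp: El_hom)
    with stage[OF k] show "\<exists>z \<in> Ob (El T A). hom (El T A) e z \<noteq> {} \<and> hom (El T A) e' z \<noteq> {}"
      by blast
  next
    fix e e' \<phi> \<psi> assume "e \<in> Ob (El T A)" "e' \<in> Ob (El T A)"
      and \<phi>: "\<phi> \<in> hom (El T A) e e'" and \<psi>: "\<psi> \<in> hom (El T A) e e'"
    then obtain x a y b where e: "e = (x, a)" "e' = (y, b)"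
      and x: "x \<in> Ob T" "a \<in> onOb A x" and y: "y \<in> Ob T" "b \<in> onOb A y"
      by (auto simp: El_Ob)
    obtain f g where f: "\<phi> = (e, f, e')" "f \<in> hom T y x" "onAr A f b = a"
      and g: "\<psi> = (e, g, e')" "g \<in> hom T y x" "onAr A g b = a"
      using \<phi> \<psi> by (auto simp: e El_hom)
    obtain k t where k: "k \<in> I" and t: "t \<in> hom T (G k) y" "s y b = germ k t"
      using nt_app[OF s y] by (auto simp: colim_Ob)
    \<comment> \<open>Both \<open>f\<close> and \<open>g\<close> take \<open>b\<close> to
      \<open>a\<close>, so by naturality of \<open>s\<close> the two germs coincide with
      \<open>s x a\<close>. A later stage therefore equalizes the two composites, which is the
      required coequalizing arrow of \<open>El T A\<close>.\<close>
    have "germ k (f \<cdot> t) = s x (onAr A f b)" "germ k (g \<cdot> t) = s x (onAr A g b)"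
      using nt_natural[OF s f(2) y(2)] nt_natural[OF s g(2) y(2)] t(2)
        colim_Ar[OF k t(1) f(2)] colim_Ar[OF k t(1) g(2)] by simp_all
    then have "germ k (f \<cdot> t) = germ k (g \<cdot> t)" using f g by simp
    then obtain l where l: "l \<in> I" "le k l" "(f \<cdot> t) \<cdot> proj l k = (g \<cdot> t) \<cdot> proj l k"
      using germ_eqE k cmp_hom[OF f(2) t(1)] cmp_hom[OF g(2) t(1)] by metis
    let ?h = "t \<cdot> proj l k"
    note \<pi> = proj_hom[OF k l(1,2)]
    have h: "?h \<in> hom T (G l) y" "onAr A ?h (\<alpha> l) = b"
      using cmp_hom[OF t(1) \<pi>] \<alpha>_cmp_proj[OF k l(1,2) t(1)] aug_germ[OF k t(1)] t(2) aug_s[OF y]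
      by simp_all
    let ?H = "(e', ?h, (G l, \<alpha> l))"
    have "?H \<in> hom (El T A) e' (G l, \<alpha> l)"
      using h y G_Ob[OF l(1)] \<alpha>_Ob[OF l(1)] by (simp add: e El_hom)
    moreover have "?H \<cdot>\<^bsub>El T A\<^esub> \<phi> = ?H \<cdot>\<^bsub>El T A\<^esub> \<psi>"
      using l(3) cmp_assoc[OF f(2) t(1) \<pi>] cmp_assoc[OF g(2) t(1) \<pi>] f(1) g(1)
      by (simp add: El_def)
    ultimately show "\<exists>z \<in> Ob (El T A). \<exists>h \<in> hom (El T A) e' z. h \<cdot>\<^bsub>El T A\<^esub> \<phi> = h \<cdot>\<^bsub>El T A\<^esub> \<psi>"
      using stage[OF l(1)] by blast
  qed
  then show ?thesis using model_A by (simp add: flat_def)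
qed

end

section \<open>Contexts of variables\<close>

text \<open>As a datatype, variables are well-founded finite trees labelled in \<open>'u\<close>.
  This permits recursion over dependencies and an injective coding into the universe; trees that
  describe no generator are excluded later by \<open>valid\<close>.\<close>

datatype 'u var = Var (deps: "'u var list") (dname: 'u) (val: 'u)

section \<open>Coding lists of variables into an infinite universe\<close>

primrec var_code :: "('u \<times> 'u \<Rightarrow> 'u) \<Rightarrow> ('u list \<Rightarrow> 'u) \<Rightarrow> 'u var \<Rightarrow> 'u" where
  "var_code c L (Var vs x y) = c (L (map (var_code c L) vs), c (x, y))"

lemma inj_var_code:
  assumes "inj c" "inj L"
  shows "inj (var_code c L)"
proof (rule injI)
  fix v w show "var_code c L v = var_code c L w \<Longrightarrow> v = w"
  proof (induction v arbitrary: w)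
    case (Var vs x y)
    obtain ws x' y' where w: "w = Var ws x' y'" by (cases w)
    have "map (var_code c L) vs = map (var_code c L) ws" "x = x'" "y = y'"
      using Var.prems by (auto simp: w dest!: injD[OF assms(1)] injD[OF assms(2)])
    moreover from this(1) have "vs = ws"
      by (rule list.inj_map_strong[rotated]) (use Var.IH in blast)
    ultimately show ?case by (simp add: w)
  qed
qed

lemma infinite_pair_code:
  assumes "infinite (UNIV :: 'u set)"
  shows "\<exists>c :: 'u \<times> 'u \<Rightarrow> 'u. inj c"
proof -
  have "\<exists>c. bij_betw c ((UNIV :: 'u set) \<times> (UNIV :: 'u set)) (UNIV :: 'u set)"
    using card_of_Times_same_infinite[OF assms] by (simp add: card_of_ordIso)
  then show ?thesis by (auto simp: bij_betw_def)
qed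

lemma infinite_list_code:
  assumes "infinite (UNIV :: 'u set)"
  shows "\<exists>L :: 'u list \<Rightarrow> 'u. inj L"
proof -
  obtain c :: "'u \<times> 'u \<Rightarrow> 'u" where c: "inj c" using infinite_pair_code[OF assms] by blast
  obtain a b :: 'u where ab: "a \<noteq> b"
    using assms by (metis (full_types) UNIV_eq_I finite.emptyI finite_insert insertI1)
  \<comment> \<open>The first components \<open>a\<close> and \<open>b\<close> tag the empty list
    and a nonempty one.\<close>
  define L where "L xs = foldr (\<lambda>x z. c (b, c (x, z))) xs (c (a, a))" for xs
  have "L xs = L ys \<Longrightarrow> xs = ys" for xs ys
  proof (induction xs arbitrary: ys)
    case Nil
    then show ?case using ab by (cases ys) (auto simp: L_def dest!: injD[OF c])
  next
    case (Cons x xs)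
    show ?case
    proof (cases ys)
      case Nil
      then show ?thesis using Cons.prems ab by (auto simp: L_def dest!: injD[OF c])
    next
      case (Cons y zs)
      with Cons.prems have "x = y" "L xs = L zs" by (auto simp: L_def dest!: injD[OF c])
      with Cons Cons.IH show ?thesis by simp
    qed
  qed
  then have "inj L" by (rule injI)
  then show ?thesis by blast
qed

lemma infinite_var_code:
  assumes "infinite (UNIV :: 'u set)"
  shows "\<exists>c :: 'u var list \<times> 'u \<Rightarrow> 'u. inj c"
proof -
  obtain c :: "'u \<times> 'u \<Rightarrow> 'u" where c: "inj c" using infinite_pair_code[OF assms] by blast
  obtain L :: "'u list \<Rightarrow> 'u" where L: "inj L" using infinite_list_code[OF assms] by blast
  have "inj (\<lambda>(vs, x). c (L (map (var_code c L) vs), x))"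
    by (rule injI) (auto dest!: injD[OF c] injD[OF L] simp: inj_map_eq_map[OF inj_var_code[OF c L]])
  then show ?thesis by blast
qed

text \<open>
  A variable \<open>v\<close> stands for a generator of the universal cover of \<open>A\<close>: a display map \<open>disp v\<close> into
  the context of the variables on which \<open>v\<close> depends, together with the element \<open>val v\<close> of \<open>A\<close> to
  which \<open>v\<close> is sent.  Arrows are named through \<open>\<iota>\<close>, so that lists of variables fit into the universe.
\<close>

locale model_variables = clan T for T :: "('o, 'a, 'm) clan_data_scheme" (structure) +
  fixes A :: "('o, 'a, 'u) set_functor" and \<iota> :: "'a \<Rightarrow> 'u"
  assumes model_A: "model T A"
    and infinite_universe: "infinite (UNIV :: 'u set)"
    and \<iota>_inj: "inj_on \<iota> (Ar T)"
begin

section \<open>Contexts and their assignments\<close>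

lemmas functor_A = model_functor[OF model_A]

text \<open>A name outside the image of \<open>\<iota>\<close> decodes to an arbitrary value;
  \<open>valid\<close> asks that the decoded arrow be a display map with the right target.\<close>

definition disp :: "'u var \<Rightarrow> 'a" where
  "disp v = inv_into (Ar T) \<iota> (dname v)"

definition one :: 'o where
  "one = (SOME t. terminal T t)"

definition pb :: "'a \<Rightarrow> 'a \<Rightarrow> 'a \<times> 'a" where
  "pb f p = (SOME (p', q). is_pullback T f p p' q)"

text \<open>
  The context of a list of variables with its projections: an iterated pullback, in which repeated
  variables are ignored.
\<close>

function cx :: "'u var list \<Rightarrow> 'o \<times> ('u var \<Rightarrow> 'a)" where
  "cx [] = (one, undefined)"
| "cx (v # l) = (if v \<in> set l then cx l else
     case pb (THE f. f \<in> hom T (fst (cx l)) (fst (cx (deps v))) \<and>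
         (\<forall>w \<in> set (deps v). snd (cx (deps v)) w \<cdot> f = snd (cx l) w)) (disp v)
     of (p', q) \<Rightarrow> (src T p', \<lambda>w. if w = v then q else snd (cx l) w \<cdot> p'))"
  by pat_completeness auto
termination
proof -
  \<comment> \<open>The dependencies are a proper part of the tree \<open>v\<close>, so the nested
    calls on \<open>deps v\<close> decrease along with those on \<open>l\<close>.\<close>
  have "size_list size (deps v) < size v" for v :: "'u var" by (cases v) simp
  then show ?thesis
    by (relation "measure (size_list size)") (auto intro: less_SucI trans_less_add1)
qed

abbreviation ctx :: "'u var list \<Rightarrow> 'o" where "ctx l \<equiv> fst (cx l)"
abbreviation ev :: "'u var list \<Rightarrow> 'u var \<Rightarrow> 'a" where "ev l \<equiv> snd (cx l)"

text \<open>This names the arrow that \<open>cx\<close> describes inline for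
  \<open>m = deps v\<close>. When all variables of \<open>m\<close> occur in \<open>l\<close>, it is
  the substitution that forgets and rearranges variables.\<close>

definition proj :: "'u var list \<Rightarrow> 'u var list \<Rightarrow> 'a" where
  "proj l m = (THE f. f \<in> hom T (ctx l) (ctx m) \<and> (\<forall>w \<in> set m. ev m w \<cdot> f = ev l w))"

lemma cx_Cons:
  "v \<in> set l \<Longrightarrow> cx (v # l) = cx l"
  "\<lbrakk>v \<notin> set l; pb (proj l (deps v)) (disp v) = (p', q)\<rbrakk>
    \<Longrightarrow> cx (v # l) = (src T p', \<lambda>w. if w = v then q else ev l w \<cdot> p')"
  by (auto simp: proj_def)

declare cx.simps(2) [simp del]

text \<open>An assignment is a compatible choice of values for the generators: the image of
  \<open>h v\<close> under the display map has the values of the dependencies as its coordinates.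
  The value type is free, so that both \<open>A\<close> and representables may serve as
  \<open>M\<close>.\<close>

definition assignment :: "('o, 'a, 'w) set_functor \<Rightarrow> 'u var list \<Rightarrow> ('u var \<Rightarrow> 'w) \<Rightarrow> bool" where
  "assignment M l h \<longleftrightarrow> (\<forall>v \<in> set l. h v \<in> onOb M (src T (disp v)) \<and>
     (\<forall>w \<in> set (deps v). onAr M (ev (deps v) w) (onAr M (disp v) (h v)) = h w))"

text \<open>This is the universal property of a context as a limit, tested in \<open>M\<close>:
  assignments come from unique elements of \<open>M\<close> at \<open>ctx l\<close>.\<close>

definition classifies :: "('o, 'a, 'w) set_functor \<Rightarrow> 'u var list \<Rightarrow> bool" where
  "classifies M l \<longleftrightarrow> (\<forall>h. assignment M l h \<longrightarrow>
     (\<exists>!k. k \<in> onOb M (ctx l) \<and> (\<forall>v \<in> set l. onAr M (ev l v) k = h v)))"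

inductive valid :: "'u var list \<Rightarrow> bool" where
  valid_Nil: "valid []"
| valid_Cons: "\<lbrakk>valid l; valid (deps v); set (deps v) \<subseteq> set l; disp v \<in> Disp T;
     trg T (disp v) = ctx (deps v); val v \<in> onOb A (src T (disp v));
     \<forall>w \<in> set (deps v). onAr A (ev (deps v) w) (onAr A (disp v) (val v)) = val w\<rbrakk>
   \<Longrightarrow> valid (v # l)"

section \<open>Valid contexts classify assignments\<close>

lemma terminal_one: "terminal T one"
  unfolding one_def using terminal_exists by (rule someI_ex)

lemma pb_pullback:
  assumes "p \<in> Disp T" "f \<in> Ar T" "trg T f = trg T p" "pb f p = (p', q)"
  shows "is_pullback T f p p' q"
proof -
  have "\<exists>x. case x of (p', q) \<Rightarrow> is_pullback T f p p' q"
    using pullback_exists[OF assms(1-3)] by auto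
  then have "case pb f p of (p', q) \<Rightarrow> is_pullback T f p p' q"
    unfolding pb_def by (rule someI_ex)
  with assms(4) show ?thesis by simp
qed

lemma valid_deps: "\<lbrakk>valid l; v \<in> set l\<rbrakk> \<Longrightarrow> set (deps v) \<subseteq> set l"
  by (induction rule: valid.induct) auto

lemma valid_append: "\<lbrakk>valid m; valid l\<rbrakk> \<Longrightarrow> valid (m @ l)"
  proof (induction rule: valid.induct)
  case (valid_Cons m v)
  then show ?case by (auto intro!: valid.valid_Cons)
qed simp

lemma valid_assignment: "valid l \<Longrightarrow> assignment A l val"
  by (induction rule: valid.induct) (auto simp: assignment_def)

lemma assignment_subset: "\<lbrakk>assignment M l h; set m \<subseteq> set l\<rbrakk> \<Longrightarrow> assignment M m h"
  by (auto simp: assignment_def)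

lemma classifies_cong:
  "\<lbrakk>classifies M l; assignment M l h; j \<in> onOb M (ctx l); k \<in> onOb M (ctx l);
    \<And>v. v \<in> set l \<Longrightarrow> onAr M (ev l v) j = h v; \<And>v. v \<in> set l \<Longrightarrow> onAr M (ev l v) k = h v\<rbrakk>
   \<Longrightarrow> j = k"
  unfolding classifies_def by blast

lemma classifies_Nil:
  assumes "model T M"
  shows "classifies M []"
  using model_terminal[OF assms terminal_one] by (simp add: classifies_def)

text \<open>An assignment on \<open>v # l\<close> consists of one on \<open>l\<close>, hence a point
  \<open>k\<close> of the old context, and a value \<open>h v\<close>. These have the same image
  over \<open>deps v\<close>, and \<open>M\<close> preserves the pullback that defines the new
  context, so they glue uniquely.\<close>

lemma classifies_Cons:
  assumes M: "model T M" and v: "v \<notin> set l" "set (deps v) \<subseteq> set l" "disp v \<in> Disp T"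
    and f: "proj l (deps v) \<in> hom T (ctx l) (ctx (deps v))"
      "\<And>w. w \<in> set (deps v) \<Longrightarrow> ev (deps v) w \<cdot> proj l (deps v) = ev l w"
    and pb: "pb (proj l (deps v)) (disp v) = (p', q)"
      "is_pullback T (proj l (deps v)) (disp v) p' q"
    and ev: "\<And>w. w \<in> set l \<Longrightarrow> ev l w \<in> hom T (ctx l) (src T (disp w))"
      "\<And>w. w \<in> set (deps v) \<Longrightarrow> ev (deps v) w \<in> hom T (ctx (deps v)) (src T (disp w))"
    and cl: "classifies M l" "classifies M (deps v)"
  shows "classifies M (v # l)"
  unfolding classifies_def
proof (intro allI impI)
  let ?f = "proj l (deps v)"
  note fM = model_functor[OF M]
  note p = is_pullbackD[OF pb(2)]
  have src: "src T ?f = ctx l" and trg: "trg T (disp v) = ctx (deps v)"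
    using hom_src[OF f(1)] hom_trg[OF f(1)] pb(2) by (auto simp: is_pullback_def)
  note p = p[unfolded src trg]
  note cx = cx_Cons(2)[OF v(1) pb(1)]
  fix h assume h: "assignment M (v # l) h"
  have hl: "assignment M l h" and hd: "assignment M (deps v) h"
    using assignment_subset[OF h] v(2) by (auto simp: subset_insertI2)
  have hv: "h v \<in> onOb M (src T (disp v))"
    "\<And>w. w \<in> set (deps v) \<Longrightarrow> onAr M (ev (deps v) w) (onAr M (disp v) (h v)) = h w"
    using h by (auto simp: assignment_def)
  obtain k where k: "k \<in> onOb M (ctx l)" "\<And>w. w \<in> set l \<Longrightarrow> onAr M (ev l w) k = h w"
    using cl(1) hl unfolding classifies_def by blast
  \<comment> \<open>Both sides have the coordinates prescribed by \<open>h\<close> on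
    \<open>deps v\<close>, so uniqueness there identifies them.\<close>
  have "onAr M ?f k = onAr M (disp v) (h v)"
  proof (rule classifies_cong[OF cl(2) hd])
    show "onAr M ?f k \<in> onOb M (ctx (deps v))" by (rule functor_app[OF fM f(1) k(1)])
    show "onAr M (disp v) (h v) \<in> onOb M (ctx (deps v))" by (rule functor_app[OF fM p(2) hv(1)])
    fix w assume w: "w \<in> set (deps v)"
    show "onAr M (ev (deps v) w) (onAr M ?f k) = h w"
      using functor_cmp[OF fM ev(2)[OF w] f(1) k(1)] f(2)[OF w] k(2) w v(2) by auto
    show "onAr M (ev (deps v) w) (onAr M (disp v) (h v)) = h w" by (rule hv(2)[OF w])
  qed
  from model_pullback[OF M v(3) pb(2) _ hv(1) this] k(1)
  have ex: "\<exists>!x. x \<in> onOb M (src T p') \<and> onAr M p' x = k \<and> onAr M q x = h v"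
    by (simp add: src)
  \<comment> \<open>The coordinates in \<open>l\<close> pin down the image under \<open>p'\<close>,
    again by uniqueness, and the coordinate \<open>v\<close> is the image under
    \<open>q\<close>.\<close>
  have iff: "(\<forall>w \<in> set (v # l). onAr M (ev (v # l) w) x = h w) \<longleftrightarrow> onAr M p' x = k \<and> onAr M q x = h v"
    if x: "x \<in> onOb M (src T p')" for x
  proof -
    have p'x: "onAr M p' x \<in> onOb M (ctx l)" by (rule functor_app[OF fM p(3) x])
    have e: "onAr M (ev (v # l) w) x = onAr M (ev l w) (onAr M p' x)" if w: "w \<in> set l" for w
      using functor_cmp[OF fM ev(1)[OF w] p(3) x] w v(1) by (auto simp: cx)
    have "(\<forall>w \<in> set l. onAr M (ev l w) (onAr M p' x) = h w) \<longleftrightarrow> onAr M p' x = k"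
      using classifies_cong[OF cl(1) hl p'x k(1)] k(2) by blast
    with e have "(\<forall>w \<in> set l. onAr M (ev (v # l) w) x = h w) \<longleftrightarrow> onAr M p' x = k" by simp
    moreover have "ev (v # l) v = q" by (simp add: cx)
    ultimately show ?thesis by auto
  qed
  have ctx: "ctx (v # l) = src T p'" by (simp add: cx)
  have "(x \<in> onOb M (ctx (v # l)) \<and> (\<forall>w \<in> set (v # l). onAr M (ev (v # l) w) x = h w)) \<longleftrightarrow>
      x \<in> onOb M (src T p') \<and> onAr M p' x = k \<and> onAr M q x = h v" for x
    unfolding ctx using iff[of x] by blast
  with ex show "\<exists>!x. x \<in> onOb M (ctx (v # l)) \<and> (\<forall>w \<in> set (v # l). onAr M (ev (v # l) w) x = h w)"
    by simp
qed

lemma valid_disp: "\<lbrakk>valid l; v \<in> set l\<rbrakk>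
    \<Longrightarrow> valid (deps v) \<and> disp v \<in> hom T (src T (disp v)) (ctx (deps v))"
proof (induction rule: valid.induct)
  case (valid_Cons l w)
  then show ?case using Ar_hom[of "disp w"] Disp_Ar by auto
qed simp

lemma repr_classifies:
  assumes "assignment (repr T X) l h" "classifies (repr T X) l"
  shows "\<exists>!k. k \<in> hom T X (ctx l) \<and> (\<forall>v \<in> set l. ev l v \<cdot> k = h v)"
  using assms by (simp add: classifies_def repr_def)

lemma assignment_precmp:
  assumes "assignment (repr T X) l h" "k \<in> hom T Y X"
    and "\<And>v. v \<in> set l \<Longrightarrow> disp v \<in> hom T (src T (disp v)) (ctx (deps v))"
    and "\<And>v w. v \<in> set l \<Longrightarrow> w \<in> set (deps v)
      \<Longrightarrow> ev (deps v) w \<in> hom T (ctx (deps v)) (src T (disp w))"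
  shows "assignment (repr T Y) l (\<lambda>v. h v \<cdot> k)"
  unfolding assignment_def
proof (intro ballI conjI)
  fix v assume v: "v \<in> set l"
  have hv: "h v \<in> hom T X (src T (disp v))"
    and hw: "\<And>w. w \<in> set (deps v) \<Longrightarrow> ev (deps v) w \<cdot> disp v \<cdot> h v = h w"
    using assms(1) v by (auto simp: assignment_def repr_def)
  show "h v \<cdot> k \<in> onOb (repr T Y) (src T (disp v))"
    using cmp_hom[OF hv assms(2)] by (simp add: repr_def)
  fix w assume w: "w \<in> set (deps v)"
  have "ev (deps v) w \<cdot> disp v \<cdot> h v \<cdot> k = h w \<cdot> k"
    using cmp_assoc[OF assms(3)[OF v] hv assms(2)]
      cmp_assoc[OF assms(4)[OF v w] cmp_hom[OF assms(3)[OF v] hv] assms(2)] hw[OF w] by simp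
  then show "onAr (repr T Y) (ev (deps v) w) (onAr (repr T Y) (disp v) (h v \<cdot> k)) = h w \<cdot> k"
    by (simp add: repr_def)
qed

lemma assignment_hom:
  "\<lbrakk>assignment (repr T X) l h; v \<in> set l\<rbrakk> \<Longrightarrow> h v \<in> hom T X (src T (disp v))"
  by (simp add: assignment_def repr_def)

lemma proj_exists:
  assumes "assignment (repr T (ctx l)) m (ev l)" "classifies (repr T (ctx l)) m"
  shows "proj l m \<in> hom T (ctx l) (ctx m)"
    and "\<And>w. w \<in> set m \<Longrightarrow> ev m w \<cdot> proj l m = ev l w"
  using theI'[OF repr_classifies[OF assms]] by (auto simp: proj_def)

text \<open>
  The universal property among representables has to be carried along this induction, as it provides
  the maps along which display maps are pulled back.
\<close>

lemma generic_assignment: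
  assumes "valid l"
  shows "ctx l \<in> Ob T \<and> assignment (repr T (ctx l)) l (ev l) \<and>
    (\<forall>X \<in> Ob T. classifies (repr T X) l) \<and>
    (\<forall>v \<in> set l. \<forall>w \<in> set (deps v). ev (deps v) w \<in> hom T (ctx (deps v)) (src T (disp w)))"
  using assms
proof (induction rule: valid.induct)
  case valid_Nil
  show ?case
    using terminal_one classifies_Nil repr_model[OF clan_axioms]
    by (auto simp: terminal_def assignment_def)
next
  case (valid_Cons l v)
  let ?d = "deps v"
  let ?f = "proj l ?d"
  show ?case
  proof (cases "v \<in> set l")
    case True
    then have "set (v # l) = set l" by auto
    with valid_Cons.IH(1) cx_Cons(1)[OF True] show ?thesis
      by (simp add: classifies_def assignment_def)
  next
    case False
    have l: "ctx l \<in> Ob T" "assignment (repr T (ctx l)) l (ev l)"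
      "\<And>X. X \<in> Ob T \<Longrightarrow> classifies (repr T X) l"
      and l': "\<And>x w. \<lbrakk>x \<in> set l; w \<in> set (deps x)\<rbrakk>
        \<Longrightarrow> ev (deps x) w \<in> hom T (ctx (deps x)) (src T (disp w))"
      and d: "ctx ?d \<in> Ob T" "assignment (repr T (ctx ?d)) ?d (ev ?d)"
      "\<And>X. X \<in> Ob T \<Longrightarrow> classifies (repr T X) ?d"
      using valid_Cons.IH by auto
    \<comment> \<open>The projections of \<open>ctx l\<close> restrict to an assignment on
      \<open>deps v\<close>; that it is classified in the representable of \<open>ctx l\<close>
      yields the arrow along which \<open>disp v\<close> is pulled back.\<close>
    note f = proj_exists[OF assignment_subset[OF l(2) valid_Cons.hyps(3)] d(3)[OF l(1)]]
    obtain p' q where pq: "pb ?f (disp v) = (p', q)" by fastforce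
    have pb: "is_pullback T ?f (disp v) p' q"
      using pb_pullback[OF valid_Cons.hyps(4) hom_Ar[OF f(1)] _ pq] hom_trg[OF f(1)]
        valid_Cons.hyps(5) by simp
    note p = is_pullbackD[OF pb, unfolded hom_src[OF f(1)] valid_Cons.hyps(5)]
    note cx = cx_Cons(2)[OF False pq]
    note ev_l = assignment_hom[OF l(2)] and ev_d = assignment_hom[OF d(2)]
    have P: "src T p' \<in> Ob T" using hom_Ob p(3) by blast
    have a: "assignment (repr T (src T p')) l (\<lambda>w. ev l w \<cdot> p')"
      using assignment_precmp[OF l(2) p(3)] valid_disp[OF valid_Cons.hyps(1)] l' by blast
    \<comment> \<open>Compatibility at the new variable is commutativity of the pullback square,
      read in the coordinate \<open>w\<close>.\<close>
    have v: "ev ?d w \<cdot> disp v \<cdot> q = ev l w \<cdot> p'" if w: "w \<in> set ?d" for w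
      using cmp_assoc[OF ev_d[OF w] f(1) p(3)] f(2)[OF w] p(5) by simp
    have "assignment (repr T (src T p')) (v # l) (ev (v # l))"
      unfolding assignment_def
    proof (intro ballI)
      fix w assume "w \<in> set (v # l)"
      then consider "w = v" | "w \<in> set l" "w \<noteq> v" by auto
      then show "ev (v # l) w \<in> onOb (repr T (src T p')) (src T (disp w)) \<and>
        (\<forall>x \<in> set (deps w). onAr (repr T (src T p')) (ev (deps w) x)
          (onAr (repr T (src T p')) (disp w) (ev (v # l) w)) = ev (v # l) x)"
      proof cases
        case 1
        then show ?thesis
          using p(4) v False valid_Cons.hyps(3) by (auto simp: cx repr_def)
      next
        case 2
        then show ?thesis
          using a valid_deps[OF valid_Cons.hyps(1) 2(1)] False
          by (auto simp: cx assignment_def repr_def)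
      qed
    qed
    moreover have "classifies (repr T X) (v # l)" if X: "X \<in> Ob T" for X
      by (rule classifies_Cons[OF repr_model[OF clan_axioms X] False valid_Cons.hyps(3,4) f pq pb
            ev_l ev_d l(3)[OF X] d(3)[OF X]])
    ultimately show ?thesis using P l' ev_d by (auto simp: cx)
  qed
qed


section \<open>Projections between valid contexts\<close>

lemma ctx_Ob: "valid l \<Longrightarrow> ctx l \<in> Ob T"
  and ev_assignment: "valid l \<Longrightarrow> assignment (repr T (ctx l)) l (ev l)"
  and valid_repr_classifies: "\<lbrakk>valid l; X \<in> Ob T\<rbrakk> \<Longrightarrow> classifies (repr T X) l"
  using generic_assignment by blast+

lemma ev_hom: "\<lbrakk>valid l; v \<in> set l\<rbrakk> \<Longrightarrow> ev l v \<in> hom T (ctx l) (src T (disp v))"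
  using assignment_hom ev_assignment by blast

lemma proj_hom: "\<lbrakk>valid l; valid m; set m \<subseteq> set l\<rbrakk> \<Longrightarrow> proj l m \<in> hom T (ctx l) (ctx m)"
  and ev_proj: "\<lbrakk>valid l; valid m; set m \<subseteq> set l; v \<in> set m\<rbrakk> \<Longrightarrow> ev m v \<cdot> proj l m = ev l v"
  using proj_exists[OF assignment_subset[OF ev_assignment]] valid_repr_classifies ctx_Ob by blast+

lemma proj_unique:
  assumes "valid l" "valid m" "set m \<subseteq> set l" "f \<in> hom T (ctx l) (ctx m)"
    "\<And>v. v \<in> set m \<Longrightarrow> ev m v \<cdot> f = ev l v"
  shows "f = proj l m"
  unfolding proj_def
  by (rule the1_equality[OF repr_classifies[OF
        assignment_subset[OF ev_assignment[OF assms(1)] assms(3)]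
        valid_repr_classifies[OF assms(2) ctx_Ob[OF assms(1)]]], symmetric])
    (use assms(4,5) in blast)

lemma valid_pullback:
  assumes "valid l" "valid (deps v)" "set (deps v) \<subseteq> set l" "disp v \<in> Disp T"
    "trg T (disp v) = ctx (deps v)" "pb (proj l (deps v)) (disp v) = (p', q)"
  shows "is_pullback T (proj l (deps v)) (disp v) p' q"
proof -
  note f = proj_hom[OF assms(1-3)]
  show ?thesis
    using pb_pullback[OF assms(4) hom_Ar[OF f] _ assms(6)] hom_trg[OF f] assms(5) by simp
qed

text \<open>With the projections constructed, the same extension step works for every model, since
  contexts are built from the terminal object by pullbacks of display maps.\<close>

lemma valid_classifies:
  assumes M: "model T M"
  shows "valid l \<Longrightarrow> classifies M l"
proof (induction rule: valid.induct)
  case valid_Nil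
  show ?case by (rule classifies_Nil[OF M])
next
  case (valid_Cons l v)
  show ?case
  proof (cases "v \<in> set l")
    case True
    then have "set (v # l) = set l" by auto
    with valid_Cons.IH(1) cx_Cons(1)[OF True] show ?thesis
      by (simp add: classifies_def assignment_def)
  next
    case False
    obtain p' q where pq: "pb (proj l (deps v)) (disp v) = (p', q)" by fastforce
    show ?thesis
      by (rule classifies_Cons[OF M False valid_Cons.hyps(3,4) proj_hom ev_proj pq
            valid_pullback[OF valid_Cons.hyps(1-5) pq] ev_hom ev_hom valid_Cons.IH])
        (use valid_Cons.hyps in auto)
  qed
qed

section \<open>The diagram of contexts in the elements of \<open>A\<close>\<close>

definition \<alpha> :: "'u var list \<Rightarrow> 'u" where
  "\<alpha> l = (THE a. a \<in> onOb A (ctx l) \<and> (\<forall>v \<in> set l. onAr A (ev l v) a = val v))"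

lemma \<alpha>_Ob: "valid l \<Longrightarrow> \<alpha> l \<in> onOb A (ctx l)"
  and \<alpha>_ev: "\<lbrakk>valid l; v \<in> set l\<rbrakk> \<Longrightarrow> onAr A (ev l v) (\<alpha> l) = val v"
proof -
  have "\<alpha> l \<in> onOb A (ctx l) \<and> (\<forall>v \<in> set l. onAr A (ev l v) (\<alpha> l) = val v)" if "valid l" for l
    unfolding \<alpha>_def
    by (rule theI'[OF valid_classifies[OF model_A that, unfolded classifies_def, rule_format,
            OF valid_assignment[OF that]]])
  then show "valid l \<Longrightarrow> \<alpha> l \<in> onOb A (ctx l)"
    "\<lbrakk>valid l; v \<in> set l\<rbrakk> \<Longrightarrow> onAr A (ev l v) (\<alpha> l) = val v" by blast+
qed

lemma \<alpha>_unique: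
  assumes "valid l" "a \<in> onOb A (ctx l)" "\<And>v. v \<in> set l \<Longrightarrow> onAr A (ev l v) a = val v"
  shows "a = \<alpha> l"
  using classifies_cong[OF valid_classifies[OF model_A] valid_assignment] assms \<alpha>_Ob \<alpha>_ev by blast

lemma \<alpha>_proj:
  assumes "valid l" "valid m" "set m \<subseteq> set l"
  shows "onAr A (proj l m) (\<alpha> l) = \<alpha> m"
proof (rule \<alpha>_unique[OF assms(2)])
  note p = proj_hom[OF assms] and a = \<alpha>_Ob[OF assms(1)]
  show "onAr A (proj l m) (\<alpha> l) \<in> onOb A (ctx m)" by (rule functor_app[OF functor_A p a])
  fix v assume v: "v \<in> set m"
  show "onAr A (ev m v) (onAr A (proj l m) (\<alpha> l)) = val v"
    using functor_cmp[OF functor_A ev_hom[OF assms(2) v] p a] ev_proj[OF assms v] \<alpha>_ev assms v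
    by auto
qed

lemma proj_cmp:
  assumes "valid l" "valid m" "valid n" "set m \<subseteq> set l" "set n \<subseteq> set m"
  shows "proj m n \<cdot> proj l m = proj l n"
proof (rule proj_unique)
  note lm = proj_hom[OF assms(1,2,4)] and mn = proj_hom[OF assms(2,3,5)]
  show "proj m n \<cdot> proj l m \<in> hom T (ctx l) (ctx n)" by (rule cmp_hom[OF mn lm])
  fix v assume v: "v \<in> set n"
  then show "ev n v \<cdot> proj m n \<cdot> proj l m = ev l v"
    using cmp_assoc[OF ev_hom[OF assms(3) v] mn lm] ev_proj[OF assms(2,3,5) v]
      ev_proj[OF assms(1,2,4)] assms(5) by auto
qed (use assms in auto)

text \<open>A lifting problem over a context is itself the datum of a variable. Adjoining that
  variable solves the problem, with its own projection as the solution.\<close>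

lemma valid_extend:
  assumes l: "valid l" and p: "p \<in> Disp T" "trg T p = ctx l"
    and y: "y \<in> onOb A (src T p)" "onAr A p y = \<alpha> l"
  shows "\<exists>m. valid m \<and> set l \<subseteq> set m \<and>
    (\<exists>e \<in> hom T (ctx m) (src T p). p \<cdot> e = proj m l \<and> onAr A e (\<alpha> m) = y)"
proof -
  define v where "v = Var l (\<iota> p) y"
  have v: "deps v = l" "disp v = p" "val v = y"
    using p(1) Disp_Ar \<iota>_inj by (auto simp: v_def disp_def)
  let ?m = "v # l"
  have m: "valid ?m"
    using l p y \<alpha>_ev[OF l] by (intro valid_Cons) (auto simp: v)
  have ls: "set l \<subseteq> set ?m" by auto
  have e: "ev ?m v \<in> hom T (ctx ?m) (src T p)" using ev_hom[OF m, of v] by (simp add: v)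
  have ph: "p \<in> hom T (src T p) (ctx l)" using Ar_hom p Disp_Ar by force
  \<comment> \<open>The two arrows into \<open>ctx l\<close> have equal coordinates: this is the
    compatibility of the projections of \<open>?m\<close> at the variable \<open>v\<close>.\<close>
  have "p \<cdot> ev ?m v = proj ?m l"
  proof (rule proj_unique[OF m l ls cmp_hom[OF ph e]])
    fix w assume "w \<in> set l"
    then show "ev l w \<cdot> p \<cdot> ev ?m v = ev ?m w"
      using ev_assignment[OF m] by (simp add: assignment_def repr_def v)
  qed
  moreover have "onAr A (ev ?m v) (\<alpha> ?m) = y" using \<alpha>_ev[OF m, of v] v by simp
  ultimately show ?thesis using m ls e by blast
qed

lemma zero_extension_flat:
  assumes "zero_extension T A"
  shows "flat T A"
proof -
  obtain c :: "'u var list \<times> 'u \<Rightarrow> 'u" where c: "inj c"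
    using infinite_var_code[OF infinite_universe] by blast
  \<comment> \<open>Contexts are preordered by inclusion of their sets of variables, so lists with
    the same variables lie below each other.\<close>
  interpret D: element_diagram T A "Collect valid" "\<lambda>m l. set m \<subseteq> set l" ctx proj \<alpha>
    "\<lambda>(l, t). c (l, \<iota> t)"
  proof
    show "Collect valid \<noteq> {}" using valid_Nil by blast
    show "\<exists>k \<in> Collect valid. set i \<subseteq> set k \<and> set j \<subseteq> set k"
      if "i \<in> Collect valid" "j \<in> Collect valid" for i j
      using that valid_append[of i j] by (intro bexI[of _ "i @ j"]) auto
    show "inj_on (\<lambda>(l, t). c (l, \<iota> t)) (Collect valid \<times> Ar T)"
      using \<iota>_inj by (auto simp: inj_on_def dest!: injD[OF c])
  qed (use model_A ctx_Ob proj_hom proj_cmp \<alpha>_Ob \<alpha>_proj in auto)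
  have "full_map T D.colim A D.aug"
    using valid_extend by (intro D.aug_full) simp
  then obtain s where "is_nt T A D.colim s" "nt_eq T A (nt_cmp D.aug s) (\<lambda>x a. a)"
    using zero_extension_section[OF clan_axioms assms] by blast
  then show ?thesis by (rule D.retract_flat)
qed

end

theorem corollaryC9:
  fixes T :: "('o, 'a) clan_data" and A :: "('o, 'a, 'u) set_functor"
  assumes "clan T"
    and "infinite (UNIV :: 'u set)"
    and "\<exists>\<iota> :: 'a \<Rightarrow> 'u. inj_on \<iota> (Ar T)"
    and "zero_extension T A"
  shows "flat T A"
proof -
  obtain \<iota> :: "'a \<Rightarrow> 'u" where "inj_on \<iota> (Ar T)" using assms(3) by blast
  moreover have "model T A"
    using assms(4) by (auto simp: zero_extension_def extension_def)
  ultimately interpret model_variables T A \<iota>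
    using assms(1,2) by (simp add: model_variables_def model_variables_axioms_def)
  show ?thesis by (rule zero_extension_flat[OF assms(4)])
qed

end
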